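(* Let $G$ be a $\sigma$-compact locally compact abelian group, $(X,G)$ a topological dynamical system, $m$ an ergodic $G$-invariant probability measure on $X$ such that $(X,G,m)$ has pure point spectrum, $\mathcal{A}=(A_n)$ a Følner sequence in $G$, and $x\in X$. Then $x$ is a Wiener–Wintner point of $(X,G,m)$ with respect to $\mathcal{A}$ if and only if $x$ is $m$-generic (with respect to $\mathcal{A}$) and Besicovitch almost periodic (with respect to $\mathcal{A}$).
   Context: $G$ is written additively, with a fixed Haar measure; $|A|$ is the Haar measure of $A\subseteq G$ and $dt$ denotes integration against it. $\widehat{G}$ is the dual group (continuous homomorphisms $G\to\{w\in\mathbb{C}:|w|=1\}$). A Følner sequence is a sequence $(A_n)$ of open relatively compact subsets of $G$ (in particular $|A_n|>0$) with $\lim_n|A_n\triangle(t+A_n)|/|A_n|=0$ for all $t\in G$. A topological dynamical system $(X,G)$ is a compact Hausdorff space $X$ with a continuous action $G\times X\to X$, $(t,x)\mapsto t.x$. Measures on $X$ are regular Borel measures. $m$ is ergodic if every measurable $f:X\to\mathbb{C}$ such that for each $t\in G$ one has $f(t.\,\cdot)=f$ $m$-a.e. is constant $m$-a.e. An eigenfunction to $\chi\in\widehat{G}$ is a nonzero $f\in L^2(X,m)$ with $f(t\,\cdot)=\chi(t)f$ in $L^2(X,m)$ for all $t\in G$; together with $0$ these form the eigenspace of $\chi$. $\mathbb{S}$ is the set of $\chi\in\widehat{G}$ having an eigenfunction. $(X,G,m)$ has pure point spectrum if the closed linear span of the eigenfunctions is all of $L^2(X,m)$. $\langle f,g\rangle=\int_Xf\overline{g}\,dm$.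 $x\in X$ is $m$-generic with respect to $\mathcal{A}$ if $\lim_n\frac{1}{|A_n|}\int_{A_n}f(t.x)\,dt=\int_Xf\,dm$ for all $f\in C(X)$. A point $x\in X$ is a Wiener–Wintner point of $(X,G,m)$ with respect to $\mathcal{A}$ if there is a set $B\subseteq\mathcal{L}^2(X,m)$ (square-integrable functions) consisting of eigenfunctions such that: (1) for each $\chi\in\mathbb{S}$ the set of $e\in B$ that are eigenfunctions to $\chi$ is an orthonormal basis of the eigenspace of $\chi$; (2) for all $f\in C(X)$ and $e\in B$ with corresponding eigenvalue $\chi_e$ the limit $\lim_n\frac{1}{|A_n|}\int_{A_n}f(t.x)\overline{\chi_e(t)}\,dt$ exists and equals $\langle f,e\rangle$. For bounded measurable $h:G\to\mathbb{C}$ put $\|h\|_b=\limsup_n\sqrt{\frac{1}{|A_n|}\int_{A_n}|h(t)|^2dt}$. A trigonometric polynomial is a finite linear combination of elements of $\widehat{G}$. A bounded measurable $h:G\to\mathbb{C}$ is Besicovitch almost periodic w.r.t. $\mathcal{A}$ if for every $\varepsilon>0$ there is a trigonometric polynomial $p$ with $\|h-p\|_b\le\varepsilon$. A point $x\in X$ is Besicovitch almost periodic w.r.t. $\mathcal{A}$ if $f_x(t)=f(t.x)$ is Besicovitch almost periodic for every $f\in C(X)$. *)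

theory Defs
  imports "HOL-Probability.Probability"
begin

text \<open>
  Regularity in the sense of Radon measures: outer regularity on all Borel sets and inner
  regularity on open sets. For finite measures this gives inner regularity on all Borel sets.
\<close>

definition regular_borel_measure :: "'a::t2_space measure \<Rightarrow> bool" where
  "regular_borel_measure \<mu> \<longleftrightarrow>
     sets \<mu> = sets borel \<and>
     (\<forall>K. compact K \<longrightarrow> emeasure \<mu> K < \<infinity>) \<and>
     (\<forall>S\<in>sets borel. emeasure \<mu> S = (INF U\<in>{U. open U \<and> S \<subseteq> U}. emeasure \<mu> U)) \<and>
     (\<forall>U. open U \<longrightarrow> emeasure \<mu> U = (SUP K\<in>{K. compact K \<and> K \<subseteq> U}. emeasure \<mu> K))"

definition haar_measure :: "'g::{topological_ab_group_add, t2_space} measure \<Rightarrow> bool" where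
  "haar_measure \<mu> \<longleftrightarrow>
     regular_borel_measure \<mu> \<and>
     emeasure \<mu> UNIV \<noteq> 0 \<and>
     (\<forall>t. \<forall>S\<in>sets borel. emeasure \<mu> ((+) t ` S) = emeasure \<mu> S)"

definition sigma_compact_space :: "'g::topological_space itself \<Rightarrow> bool" where
  "sigma_compact_space _ \<longleftrightarrow>
     (\<exists>K :: nat \<Rightarrow> 'g set. (\<forall>n. compact (K n)) \<and> (\<Union>n. K n) = UNIV)"

definition topological_dynamical_system ::
    "('g::{topological_ab_group_add, t2_space} \<Rightarrow> 'x::t2_space \<Rightarrow> 'x) \<Rightarrow> bool" where
  "topological_dynamical_system act \<longleftrightarrow>
     compact (UNIV :: 'x set) \<and>
     (\<forall>x. act 0 x = x) \<and>
     (\<forall>s t x. act (s + t) x = act s (act t x)) \<and>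
     continuous_on UNIV (\<lambda>(t, x). act t x)"

definition invariant_probability_measure ::
    "('g \<Rightarrow> 'x::t2_space \<Rightarrow> 'x) \<Rightarrow> 'x measure \<Rightarrow> bool" where
  "invariant_probability_measure act m \<longleftrightarrow>
     regular_borel_measure m \<and> prob_space m \<and> (\<forall>t. distr m m (act t) = m)"

definition ergodic_measure :: "('g \<Rightarrow> 'x \<Rightarrow> 'x) \<Rightarrow> 'x measure \<Rightarrow> bool" where
  "ergodic_measure act m \<longleftrightarrow>
     (\<forall>f :: 'x \<Rightarrow> complex. f \<in> borel_measurable m \<longrightarrow>
        (\<forall>t. AE x in m. f (act t x) = f x) \<longrightarrow> (\<exists>c. AE x in m. f x = c))"

text \<open>The elements of the dual group, as complex-valued functions.\<close>

definition dual_group :: "('g::topological_ab_group_add \<Rightarrow> complex) set" where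
  "dual_group = {\<gamma>. continuous_on UNIV \<gamma> \<and> (\<forall>s t. \<gamma> (s + t) = \<gamma> s * \<gamma> t) \<and> (\<forall>t. cmod (\<gamma> t) = 1)}"

text \<open>
  Elements of $L^2(X,m)$ are represented by square-integrable functions rather than by classes
  modulo null sets; every set below that stands for a closed subspace of $L^2(X,m)$ contains
  all representatives of its elements.
\<close>

definition sq_integrable :: "'x measure \<Rightarrow> ('x \<Rightarrow> complex) set" where
  "sq_integrable m = {f \<in> borel_measurable m. integrable m (\<lambda>x. (cmod (f x))\<^sup>2)}"

definition l2_inner :: "'x measure \<Rightarrow> ('x \<Rightarrow> complex) \<Rightarrow> ('x \<Rightarrow> complex) \<Rightarrow> complex" where
  "l2_inner m f g = (LINT x|m. f x * cnj (g x))"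

definition l2_norm :: "'x measure \<Rightarrow> ('x \<Rightarrow> complex) \<Rightarrow> real" where
  "l2_norm m f = sqrt (LINT x|m. (cmod (f x))\<^sup>2)"

definition lin_combs :: "('a \<Rightarrow> complex) set \<Rightarrow> ('a \<Rightarrow> complex) set" where
  "lin_combs S = {(\<lambda>x. \<Sum>e\<in>F. c e * e x) | F c. finite F \<and> F \<subseteq> S}"

definition l2_closed_span :: "'x measure \<Rightarrow> ('x \<Rightarrow> complex) set \<Rightarrow> ('x \<Rightarrow> complex) set" where
  "l2_closed_span m S =
     {f \<in> sq_integrable m. \<forall>\<epsilon>>0. \<exists>g\<in>lin_combs S. l2_norm m (\<lambda>x. f x - g x) < \<epsilon>}"

definition orthonormal_basis_of ::
    "'x measure \<Rightarrow> ('x \<Rightarrow> complex) set \<Rightarrow> ('x \<Rightarrow> complex) set \<Rightarrow> bool" where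
  "orthonormal_basis_of m S V \<longleftrightarrow>
     S \<subseteq> sq_integrable m \<and>
     (\<forall>e\<in>S. \<forall>e'\<in>S. l2_inner m e e' = (if e = e' then 1 else 0)) \<and>
     l2_closed_span m S = V"

definition eigenspace ::
    "('g \<Rightarrow> 'x \<Rightarrow> 'x) \<Rightarrow> 'x measure \<Rightarrow> ('g \<Rightarrow> complex) \<Rightarrow> ('x \<Rightarrow> complex) set" where
  "eigenspace act m \<gamma> =
     {f \<in> sq_integrable m. \<forall>t. AE x in m. f (act t x) = \<gamma> t * f x}"

definition eigenfunction ::
    "('g::topological_ab_group_add \<Rightarrow> 'x \<Rightarrow> 'x) \<Rightarrow> 'x measure \<Rightarrow> ('g \<Rightarrow> complex) \<Rightarrow>
     ('x \<Rightarrow> complex) \<Rightarrow> bool" where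
  "eigenfunction act m \<gamma> f \<longleftrightarrow>
     \<gamma> \<in> dual_group \<and> f \<in> eigenspace act m \<gamma> \<and> \<not> (AE x in m. f x = 0)"

definition eigenvalues ::
    "('g::topological_ab_group_add \<Rightarrow> 'x \<Rightarrow> 'x) \<Rightarrow> 'x measure \<Rightarrow> ('g \<Rightarrow> complex) set" where
  "eigenvalues act m = {\<gamma>. \<exists>f. eigenfunction act m \<gamma> f}"

definition pure_point_spectrum ::
    "('g::topological_ab_group_add \<Rightarrow> 'x \<Rightarrow> 'x) \<Rightarrow> 'x measure \<Rightarrow> bool" where
  "pure_point_spectrum act m \<longleftrightarrow>
     l2_closed_span m {f. \<exists>\<gamma>. eigenfunction act m \<gamma> f} = sq_integrable m"

definition folner_sequence ::
    "'g::{topological_ab_group_add, t2_space} measure \<Rightarrow> (nat \<Rightarrow> 'g set) \<Rightarrow> bool" where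
  "folner_sequence \<mu> A \<longleftrightarrow>
     (\<forall>n. open (A n) \<and> compact (closure (A n)) \<and> 0 < measure \<mu> (A n)) \<and>
     (\<forall>t. (\<lambda>n. measure \<mu> (sym_diff (A n) ((+) t ` A n)) / measure \<mu> (A n))
            \<longlonglongrightarrow> 0)"

definition average ::
    "'g measure \<Rightarrow> 'g set \<Rightarrow> ('g \<Rightarrow> 'b::{banach, second_countable_topology}) \<Rightarrow> 'b" where
  "average \<mu> S h = (1 / measure \<mu> S) *\<^sub>R (LINT t:S|\<mu>. h t)"

definition generic_point ::
    "'g measure \<Rightarrow> (nat \<Rightarrow> 'g set) \<Rightarrow> ('g \<Rightarrow> 'x::topological_space \<Rightarrow> 'x) \<Rightarrow> 'x measure \<Rightarrow>
     'x \<Rightarrow> bool" where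
  "generic_point \<mu> A act m x \<longleftrightarrow>
     (\<forall>f :: 'x \<Rightarrow> complex. continuous_on UNIV f \<longrightarrow>
        (\<lambda>n. average \<mu> (A n) (\<lambda>t. f (act t x))) \<longlonglongrightarrow> (LINT y|m. f y))"

definition wiener_wintner_point ::
    "'g::topological_ab_group_add measure \<Rightarrow> (nat \<Rightarrow> 'g set) \<Rightarrow>
     ('g \<Rightarrow> 'x::topological_space \<Rightarrow> 'x) \<Rightarrow> 'x measure \<Rightarrow> 'x \<Rightarrow> bool" where
  "wiener_wintner_point \<mu> A act m x \<longleftrightarrow>
     (\<exists>B. (\<forall>e\<in>B. \<exists>\<gamma>. eigenfunction act m \<gamma> e) \<and>
          (\<forall>\<gamma>\<in>eigenvalues act m.
             orthonormal_basis_of m {e \<in> B. eigenfunction act m \<gamma> e} (eigenspace act m \<gamma>)) \<and>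
          (\<forall>f. continuous_on UNIV f \<longrightarrow>
             (\<forall>e\<in>B. \<forall>\<gamma>. eigenfunction act m \<gamma> e \<longrightarrow>
                (\<lambda>n. average \<mu> (A n) (\<lambda>t. f (act t x) * cnj (\<gamma> t))) \<longlonglongrightarrow> l2_inner m f e)))"

definition besicovitch_seminorm ::
    "'g measure \<Rightarrow> (nat \<Rightarrow> 'g set) \<Rightarrow> ('g \<Rightarrow> complex) \<Rightarrow> ereal" where
  "besicovitch_seminorm \<mu> A h =
     limsup (\<lambda>n. ereal (sqrt (average \<mu> (A n) (\<lambda>t. (cmod (h t))\<^sup>2))))"

definition besicovitch_ap_function ::
    "'g::topological_ab_group_add measure \<Rightarrow> (nat \<Rightarrow> 'g set) \<Rightarrow> ('g \<Rightarrow> complex) \<Rightarrow> bool" where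
  "besicovitch_ap_function \<mu> A h \<longleftrightarrow>
     h \<in> borel_measurable \<mu> \<and> bounded (range h) \<and>
     (\<forall>\<epsilon>::real. 0 < \<epsilon> \<longrightarrow>
        (\<exists>p\<in>lin_combs dual_group. besicovitch_seminorm \<mu> A (\<lambda>t. h t - p t) \<le> ereal \<epsilon>))"

definition besicovitch_ap_point ::
    "'g::topological_ab_group_add measure \<Rightarrow> (nat \<Rightarrow> 'g set) \<Rightarrow>
     ('g \<Rightarrow> 'x::topological_space \<Rightarrow> 'x) \<Rightarrow> 'x \<Rightarrow> bool" where
  "besicovitch_ap_point \<mu> A act x \<longleftrightarrow>
     (\<forall>f :: 'x \<Rightarrow> complex. continuous_on UNIV f \<longrightarrow>
        besicovitch_ap_function \<mu> A (\<lambda>t. f (act t x)))"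

end

theory Submission
  imports Defs
begin

text \<open>
  For a continuous function \<open>f\<close> on the space, compare the Fourier coefficients of the function
  \<open>t \<mapsto> f (act t x)\<close> along the orbit of \<open>x\<close>, formed with means over the Folner sets, with the
  coefficients \<open>\<langle>f, e\<rangle>\<close> of \<open>f\<close> at the eigenfunctions. In an ergodic system each eigenspace is a
  line, so with pure point spectrum a choice of one unit eigenfunction for each eigenvalue is an
  orthonormal basis of \<open>L\<^sup>2\<close>. On the group side, distinct characters are asymptotically
  orthonormal for the means. So the same expansion of
  \<open>\<parallel>h - (\<Sum>i\<in>F. c i * e i)\<parallel>\<^sup>2\<close> in terms of the coefficients holds on both sides: exactly in \<open>L\<^sup>2\<close>, and in the
  limit for the means (\<open>l2_norm_diff_orthonormal_combination\<close>, \<open>trigonometric_distance_limit\<close>).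

  If \<open>x\<close> is a Wiener--Wintner point, the two kinds of coefficients agree. The trivial character
  gives genericity, hence also the agreement of the mean of \<open>|f|\<^sup>2\<close> along the orbit with
  \<open>\<parallel>f\<parallel>\<^sup>2\<close>. Then the Besicovitch distance from the orbit function to its Fourier polynomial equals
  the \<open>L\<^sup>2\<close> distance from \<open>f\<close> to its own, which is small by pure point spectrum.

  Conversely, almost periodicity makes the coefficients of the orbit function exist. By genericity
  the coefficient at \<open>\<gamma>\<close> is a functional of \<open>f\<close> bounded by the \<open>L\<^sup>2\<close> norm, and by the Folner
  property it transforms under the action by \<open>\<gamma>\<close>. Such a functional is a multiple \<open>d\<close>, with
  \<open>|d| \<le> 1\<close>, of the coefficient at the eigenfunction for \<open>\<gamma>\<close>, or 0 if there is none
  (\<open>functional_eq_coefficient\<close>). The squares of the coefficients of \<open>f\<close> sum up to at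
  most \<open>\<parallel>f\<parallel>\<^sup>2\<close> by Bessel's inequality, and those of the orbit function, by almost periodicity, to
  all of it; comparing the two forces \<open>|d| = 1\<close> (\<open>coefficient_factor_unimodular\<close>).
  Rotating each eigenfunction by its factor then yields the family that a Wiener--Wintner point
  requires.
\<close>

section \<open>Square-integrable functions\<close>

lemma measurable_cnj [measurable (raw)]:
  "f \<in> borel_measurable M \<Longrightarrow> (\<lambda>x. cnj (f x)) \<in> borel_measurable M"
  by (rule measurable_compose[OF _ borel_measurable_continuous_onI]) (auto intro!: continuous_intros)

lemma sq_integrable_measurable [measurable_dest]: "f \<in> sq_integrable M \<Longrightarrow> f \<in> borel_measurable M"
  by (simp add: sq_integrable_def)

lemma sq_integrable_integrable_square: "f \<in> sq_integrable M \<Longrightarrow> integrable M (\<lambda>x. (cmod (f x))\<^sup>2)"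
  by (simp add: sq_integrable_def)

lemma sq_integrable_integrable_mult_cnj:
  assumes f: "f \<in> sq_integrable M" and g: "g \<in> sq_integrable M"
  shows "integrable M (\<lambda>x. f x * cnj (g x))"
proof (rule Bochner_Integration.integrable_bound)
  show "integrable M (\<lambda>x. (cmod (f x))\<^sup>2 + (cmod (g x))\<^sup>2)"
    using assms by (intro Bochner_Integration.integrable_add sq_integrable_integrable_square)
  show "(\<lambda>x. f x * cnj (g x)) \<in> borel_measurable M"
    using f g by measurable
  have "cmod (f x) * cmod (g x) \<le> (cmod (f x))\<^sup>2 + (cmod (g x))\<^sup>2" for x
    using sum_squares_bound[of "cmod (f x)" "cmod (g x)"]
      mult_nonneg_nonneg[of "cmod (f x)" "cmod (g x)", OF norm_ge_zero norm_ge_zero] by linarith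
  then show "AE x in M. cmod (f x * cnj (g x)) \<le> norm ((cmod (f x))\<^sup>2 + (cmod (g x))\<^sup>2)"
    by (auto simp: norm_mult)
qed

lemma sq_integrable_scale [intro]:
  assumes "f \<in> sq_integrable M"
  shows "(\<lambda>x. c * f x) \<in> sq_integrable M"
  using assms unfolding sq_integrable_def by (auto simp: norm_mult power_mult_distrib)

lemma sq_integrable_zero [simp]: "(\<lambda>x. 0) \<in> sq_integrable M"
  unfolding sq_integrable_def by simp

lemma sq_integrable_add [intro]:
  assumes f: "f \<in> sq_integrable M" and g: "g \<in> sq_integrable M"
  shows "(\<lambda>x. f x + g x) \<in> sq_integrable M"
proof -
  have "integrable M (\<lambda>x. (cmod (f x + g x))\<^sup>2)"
  proof (rule Bochner_Integration.integrable_bound)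
    show "integrable M (\<lambda>x. 2 * (cmod (f x))\<^sup>2 + 2 * (cmod (g x))\<^sup>2)"
      using assms by (intro Bochner_Integration.integrable_add integrable_mult_right
          sq_integrable_integrable_square)
    show "(\<lambda>x. (cmod (f x + g x))\<^sup>2) \<in> borel_measurable M"
      using f g by measurable
    have "(cmod (f x + g x))\<^sup>2 \<le> 2 * (cmod (f x))\<^sup>2 + 2 * (cmod (g x))\<^sup>2" for x
    proof -
      have "(cmod (f x + g x))\<^sup>2 \<le> (cmod (f x) + cmod (g x))\<^sup>2"
        by (intro power_mono norm_triangle_ineq) auto
      also have "\<dots> \<le> 2 * (cmod (f x))\<^sup>2 + 2 * (cmod (g x))\<^sup>2"
        using sum_squares_bound[of "cmod (f x)" "cmod (g x)"] by (simp add: power2_sum)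
      finally show ?thesis .
    qed
    then show "AE x in M. norm ((cmod (f x + g x))\<^sup>2)
                 \<le> norm (2 * (cmod (f x))\<^sup>2 + 2 * (cmod (g x))\<^sup>2)"
      by auto
  qed
  then show ?thesis
    using f g unfolding sq_integrable_def by auto
qed

lemma sq_integrable_diff [intro]:
  assumes "f \<in> sq_integrable M" and "g \<in> sq_integrable M"
  shows "(\<lambda>x. f x - g x) \<in> sq_integrable M"
  using sq_integrable_add[OF assms(1) sq_integrable_scale[OF assms(2), of "-1"]] by simp

lemma sq_integrable_combination [intro]:
  assumes "\<And>i. i \<in> F \<Longrightarrow> e i \<in> sq_integrable M"
  shows "(\<lambda>x. \<Sum>i\<in>F. c i * e i x) \<in> sq_integrable M"
  using assms
proof (induction F rule: infinite_finite_induct)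
  case (insert i F)
  have "(\<lambda>x. c i * e i x) \<in> sq_integrable M" "(\<lambda>x. \<Sum>i\<in>F. c i * e i x) \<in> sq_integrable M"
    using insert by auto
  then show ?case
    using insert.hyps by (simp add: sq_integrable_add)
qed auto

lemma (in finite_measure) bounded_sq_integrable:
  assumes "f \<in> borel_measurable M" and "\<And>x. cmod (f x) \<le> C"
  shows "f \<in> sq_integrable M"
proof -
  have "integrable M (\<lambda>x. (cmod (f x))\<^sup>2)"
    using assms by (intro integrable_const_bound[where B = "C\<^sup>2"])
      (auto intro!: power_mono)
  then show ?thesis
    using assms by (simp add: sq_integrable_def)
qed

lemma (in finite_measure) sq_integrable_const: "(\<lambda>x. c) \<in> sq_integrable M"
  by (rule bounded_sq_integrable[where C = "cmod c"]) auto

lemma sq_integrable_cong_AE: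
  assumes "f \<in> sq_integrable M" and "g \<in> borel_measurable M" and "AE x in M. f x = g x"
  shows "g \<in> sq_integrable M"
proof -
  have "integrable M (\<lambda>x. (cmod (g x))\<^sup>2)"
    by (rule Bochner_Integration.integrable_bound[OF sq_integrable_integrable_square[OF assms(1)]])
      (use assms in auto)
  then show ?thesis
    using assms by (simp add: sq_integrable_def)
qed

subsection \<open>The inner product\<close>

lemma l2_norm_nonneg [simp]: "0 \<le> l2_norm M f"
  by (simp add: l2_norm_def)

lemma l2_norm_power2: "(l2_norm M f)\<^sup>2 = (LINT x|M. (cmod (f x))\<^sup>2)"
  by (simp add: l2_norm_def)

lemma l2_inner_self: "l2_inner M f f = complex_of_real ((l2_norm M f)\<^sup>2)"
proof -
  have "(\<lambda>x. f x * cnj (f x)) = (\<lambda>x. complex_of_real ((cmod (f x))\<^sup>2))"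
    by (simp only: complex_norm_square)
  then show ?thesis
    unfolding l2_inner_def l2_norm_power2 by (metis integral_complex_of_real)
qed

lemma l2_inner_commute: "l2_inner M g f = cnj (l2_inner M f g)"
proof -
  have "cnj (l2_inner M f g) = (LINT x|M. cnj (f x * cnj (g x)))"
    unfolding l2_inner_def by (rule Bochner_Integration.integral_cnj[symmetric])
  then show ?thesis by (simp add: l2_inner_def mult.commute)
qed

lemma l2_inner_scale_left: "l2_inner M (\<lambda>x. c * f x) g = c * l2_inner M f g"
  by (simp add: l2_inner_def mult.assoc)

lemma l2_inner_scale_right: "l2_inner M f (\<lambda>x. c * g x) = cnj c * l2_inner M f g"
  by (subst (1 2) l2_inner_commute) (simp add: l2_inner_scale_left)

lemma l2_inner_add_left:
  assumes "f \<in> sq_integrable M" "g \<in> sq_integrable M" "h \<in> sq_integrable M"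
  shows "l2_inner M (\<lambda>x. f x + g x) h = l2_inner M f h + l2_inner M g h"
  using assms by (simp add: l2_inner_def distrib_right sq_integrable_integrable_mult_cnj)

lemma l2_inner_diff_left:
  assumes "f \<in> sq_integrable M" "g \<in> sq_integrable M" "h \<in> sq_integrable M"
  shows "l2_inner M (\<lambda>x. f x - g x) h = l2_inner M f h - l2_inner M g h"
  using assms by (simp add: l2_inner_def left_diff_distrib sq_integrable_integrable_mult_cnj)

lemma l2_inner_diff_right:
  assumes "f \<in> sq_integrable M" "g \<in> sq_integrable M" "h \<in> sq_integrable M"
  shows "l2_inner M h (\<lambda>x. f x - g x) = l2_inner M h f - l2_inner M h g"
  by (subst (1 2 3) l2_inner_commute) (simp add: l2_inner_diff_left assms)

lemma l2_inner_combination_left: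
  assumes "\<And>i. i \<in> F \<Longrightarrow> e i \<in> sq_integrable M" and "h \<in> sq_integrable M"
  shows "l2_inner M (\<lambda>x. \<Sum>i\<in>F. c i * e i x) h = (\<Sum>i\<in>F. c i * l2_inner M (e i) h)"
  using assms
proof (induction F rule: infinite_finite_induct)
  case (insert i F)
  have "l2_inner M (\<lambda>x. c i * e i x + (\<Sum>i\<in>F. c i * e i x)) h
      = l2_inner M (\<lambda>x. c i * e i x) h + l2_inner M (\<lambda>x. \<Sum>i\<in>F. c i * e i x) h"
    using insert.prems by (intro l2_inner_add_left sq_integrable_scale sq_integrable_combination) auto
  then show ?case
    using insert by (simp add: l2_inner_scale_left)
qed (auto simp: l2_inner_def)

lemma l2_inner_combination_right:
  assumes "\<And>i. i \<in> F \<Longrightarrow> e i \<in> sq_integrable M" and "h \<in> sq_integrable M"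
  shows "l2_inner M h (\<lambda>x. \<Sum>i\<in>F. c i * e i x) = (\<Sum>i\<in>F. cnj (c i) * l2_inner M h (e i))"
  by (subst (1 2) l2_inner_commute) (simp add: l2_inner_combination_left assms)

lemma l2_norm_diff_power2:
  assumes "f \<in> sq_integrable M" "g \<in> sq_integrable M"
  shows "complex_of_real ((l2_norm M (\<lambda>x. f x - g x))\<^sup>2)
       = l2_inner M f f - l2_inner M f g - cnj (l2_inner M f g) + l2_inner M g g"
proof -
  have "l2_inner M (\<lambda>x. f x - g x) (\<lambda>x. f x - g x)
      = l2_inner M f f - l2_inner M f g - (l2_inner M g f - l2_inner M g g)"
    using assms by (simp add: l2_inner_diff_left l2_inner_diff_right sq_integrable_diff)
  then show ?thesis
    by (simp only: l2_inner_self[symmetric] l2_inner_commute[of M f g]) simp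
qed

text \<open>Characters are orthonormal for the means only in the limit, so the expansion keeps the whole
  Gram matrix of the family.\<close>

lemma l2_norm_diff_combination_power2:
  assumes f: "f \<in> sq_integrable M" and e: "\<And>i. i \<in> F \<Longrightarrow> e i \<in> sq_integrable M"
  shows "complex_of_real ((l2_norm M (\<lambda>x. f x - (\<Sum>i\<in>F. c i * e i x)))\<^sup>2)
       = l2_inner M f f - (\<Sum>i\<in>F. cnj (c i) * l2_inner M f (e i))
           - cnj (\<Sum>i\<in>F. cnj (c i) * l2_inner M f (e i))
           + (\<Sum>i\<in>F. \<Sum>j\<in>F. c i * (cnj (c j) * l2_inner M (e i) (e j)))"
proof -
  have g: "(\<lambda>x. \<Sum>i\<in>F. c i * e i x) \<in> sq_integrable M"
    using e by blast
  have "l2_inner M (\<lambda>x. \<Sum>i\<in>F. c i * e i x) (\<lambda>x. \<Sum>i\<in>F. c i * e i x)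
      = (\<Sum>i\<in>F. \<Sum>j\<in>F. c i * (cnj (c j) * l2_inner M (e i) (e j)))"
    by (subst l2_inner_combination_left[OF e g], simp,
        rule sum.cong[OF refl], subst l2_inner_combination_right[OF e])
      (auto simp: e sum_distrib_left)
  then show ?thesis
    by (subst l2_norm_diff_power2[OF f g], simp add: l2_inner_combination_right[OF e f])
qed

subsection \<open>Norm inequalities\<close>

lemma l2_norm_eq_0_imp_AE:
  assumes "f \<in> sq_integrable M" and "l2_norm M f = 0"
  shows "AE x in M. f x = 0"
proof -
  have "AE x in M. (cmod (f x))\<^sup>2 = 0"
    using assms integral_nonneg_eq_0_iff_AE[OF sq_integrable_integrable_square[OF assms(1)]]
    by (simp add: l2_norm_def)
  then show ?thesis by auto
qed

lemma l2_norm_cong_AE: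
  assumes "f \<in> borel_measurable M" "g \<in> borel_measurable M" "AE x in M. f x = g x"
  shows "l2_norm M f = l2_norm M g"
proof -
  have "(LINT x|M. (cmod (f x))\<^sup>2) = (LINT x|M. (cmod (g x))\<^sup>2)"
    by (rule integral_cong_AE) (use assms in auto)
  then show ?thesis
    by (simp add: l2_norm_def)
qed

lemma l2_inner_cong_AE:
  assumes "f \<in> borel_measurable M" "g \<in> borel_measurable M"
    "f' \<in> borel_measurable M" "g' \<in> borel_measurable M"
    "AE x in M. f x = f' x" "AE x in M. g x = g' x"
  shows "l2_inner M f g = l2_inner M f' g'"
  unfolding l2_inner_def by (rule integral_cong_AE) (use assms in auto)

lemma l2_norm_scale: "l2_norm M (\<lambda>x. c * f x) = cmod c * l2_norm M f"
  by (simp add: l2_norm_def norm_mult power_mult_distrib real_sqrt_mult)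

lemma l2_inner_eq_0_if_norm_eq_0:
  assumes "f \<in> sq_integrable M" "g \<in> sq_integrable M" "l2_norm M g = 0"
  shows "l2_inner M f g = 0"
proof -
  have "l2_inner M f g = l2_inner M f (\<lambda>x. 0)"
    using assms l2_norm_eq_0_imp_AE[of g M] by (intro l2_inner_cong_AE) auto
  then show ?thesis
    by (simp add: l2_inner_def)
qed

lemma l2_cauchy_schwarz:
  assumes f: "f \<in> sq_integrable M" and g: "g \<in> sq_integrable M"
  shows "cmod (l2_inner M f g) \<le> l2_norm M f * l2_norm M g"
proof (cases "l2_norm M g = 0")
  case True
  then show ?thesis
    using assms by (simp add: l2_inner_eq_0_if_norm_eq_0)
next
  case False
  define b where "b = l2_norm M g"
  define z where "z = l2_inner M f g"
  define c where "c = z / complex_of_real (b\<^sup>2)"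
  have b: "b > 0"
    using False by (simp add: b_def order_less_le)
  have gg: "l2_inner M g g = complex_of_real (b\<^sup>2)"
    by (simp add: l2_inner_self b_def)
  have "complex_of_real ((l2_norm M (\<lambda>x. f x - c * g x))\<^sup>2)
      = complex_of_real ((l2_norm M f)\<^sup>2) - cnj c * z - cnj (cnj c * z)
          + c * cnj c * complex_of_real (b\<^sup>2)"
    using l2_norm_diff_power2[OF f sq_integrable_scale[OF g]]
    by (simp add: l2_inner_self[of M f] l2_inner_scale_left l2_inner_scale_right gg z_def)
  also have "\<dots> = complex_of_real ((l2_norm M f)\<^sup>2) - complex_of_real ((cmod z)\<^sup>2 / b\<^sup>2)"
  proof -
    define B where "B = complex_of_real (b\<^sup>2)"
    have B: "B \<noteq> 0" "cnj B = B"
      using b by (auto simp: B_def)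
    have W: "complex_of_real ((cmod z)\<^sup>2 / b\<^sup>2) = z * cnj z / B"
      by (simp only: of_real_divide complex_norm_square B_def)
    show ?thesis
      unfolding W unfolding c_def B_def[symmetric] using B by (simp add: mult.commute)
  qed
  finally have "(l2_norm M (\<lambda>x. f x - c * g x))\<^sup>2 = (l2_norm M f)\<^sup>2 - (cmod z)\<^sup>2 / b\<^sup>2"
    by (simp only: of_real_diff[symmetric] of_real_eq_iff)
  then have "(cmod z)\<^sup>2 / b\<^sup>2 \<le> (l2_norm M f)\<^sup>2"
    using zero_le_power2[of "l2_norm M (\<lambda>x. f x - c * g x)"] by linarith
  then have "(cmod z)\<^sup>2 \<le> (l2_norm M f * b)\<^sup>2"
    using b by (simp add: pos_divide_le_eq power_mult_distrib)
  then have "cmod z \<le> l2_norm M f * b"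
    by (rule power2_le_imp_le) (use b in simp)
  then show ?thesis
    by (simp add: z_def b_def)
qed

lemma l2_norm_triangle:
  assumes f: "f \<in> sq_integrable M" and g: "g \<in> sq_integrable M"
  shows "l2_norm M (\<lambda>x. f x + g x) \<le> l2_norm M f + l2_norm M g"
proof -
  have g': "(\<lambda>x. (-1) * g x) \<in> sq_integrable M"
    using g by blast
  have "complex_of_real ((l2_norm M (\<lambda>x. f x - (-1) * g x))\<^sup>2)
     = complex_of_real ((l2_norm M f)\<^sup>2) + l2_inner M f g + cnj (l2_inner M f g)
         + complex_of_real ((l2_norm M g)\<^sup>2)"
    by (subst l2_norm_diff_power2[OF f g'])
       (simp only: l2_inner_scale_left l2_inner_scale_right l2_inner_self, simp)
  also have "\<dots> = complex_of_real ((l2_norm M f)\<^sup>2 + 2 * Re (l2_inner M f g) + (l2_norm M g)\<^sup>2)"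
    by (simp add: complex_eq_iff)
  finally have "(l2_norm M (\<lambda>x. f x + g x))\<^sup>2
      = (l2_norm M f)\<^sup>2 + 2 * Re (l2_inner M f g) + (l2_norm M g)\<^sup>2"
    by (simp only: of_real_eq_iff) simp
  also have "\<dots> \<le> (l2_norm M f + l2_norm M g)\<^sup>2"
    using l2_cauchy_schwarz[OF f g] complex_Re_le_cmod[of "l2_inner M f g"]
    by (simp add: power2_sum)
  finally show ?thesis
    by (rule power2_le_imp_le) simp
qed

lemma l2_norm_minus_commute: "l2_norm M (\<lambda>x. f x - g x) = l2_norm M (\<lambda>x. g x - f x)"
  by (simp add: l2_norm_def norm_minus_commute)

lemma l2_norm_diff_triangle:
  assumes "f \<in> sq_integrable M" "g \<in> sq_integrable M" "h \<in> sq_integrable M"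
  shows "l2_norm M (\<lambda>x. f x - h x) \<le> l2_norm M (\<lambda>x. f x - g x) + l2_norm M (\<lambda>x. g x - h x)"
  using l2_norm_triangle[of "\<lambda>x. f x - g x" M "\<lambda>x. g x - h x"] assms by auto

lemma (in prob_space) l2_norm_const: "l2_norm M (\<lambda>x. c) = cmod c"
  by (simp add: l2_norm_def prob_space)

text \<open>This is the expansion with Gram matrix the identity. The matrix is left as a double sum because
  it has this form as the limit of the Gram matrices of the characters.\<close>

lemma complete_square_orthonormal:
  assumes "finite F"
  shows "complex_of_real N - (\<Sum>i\<in>F. cnj (c i) * a i) - cnj (\<Sum>i\<in>F. cnj (c i) * a i)
           + (\<Sum>i\<in>F. \<Sum>j\<in>F. c i * (cnj (c j) * (if i = j then 1 else 0)))
       = complex_of_real (N - (\<Sum>i\<in>F. (cmod (a i))\<^sup>2) + (\<Sum>i\<in>F. (cmod (c i - a i))\<^sup>2))"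
proof -
  have "(\<Sum>i\<in>F. \<Sum>j\<in>F. c i * (cnj (c j) * (if i = j then 1 else 0))) = (\<Sum>i\<in>F. c i * cnj (c i))"
    by (intro sum.cong refl) (simp add: assms if_distrib[of "\<lambda>z. _ * z"] cong: if_cong)
  then show ?thesis
    by (simp only: of_real_add of_real_diff of_real_sum complex_norm_square)
      (simp add: algebra_simps sum.distrib sum_subtractf)
qed

text \<open>Bessel's inequality, together with the fact that the Fourier coefficients give the best
  approximation.\<close>

lemma l2_norm_diff_orthonormal_combination:
  assumes f: "f \<in> sq_integrable M" and e: "\<And>i. i \<in> F \<Longrightarrow> e i \<in> sq_integrable M"
    and fin: "finite F"
    and on: "\<And>i j. i \<in> F \<Longrightarrow> j \<in> F \<Longrightarrow> l2_inner M (e i) (e j) = (if i = j then 1 else 0)"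
  shows "(l2_norm M (\<lambda>x. f x - (\<Sum>i\<in>F. c i * e i x)))\<^sup>2
       = (l2_norm M f)\<^sup>2 - (\<Sum>i\<in>F. (cmod (l2_inner M f (e i)))\<^sup>2)
           + (\<Sum>i\<in>F. (cmod (c i - l2_inner M f (e i)))\<^sup>2)"
proof -
  have "(\<Sum>i\<in>F. \<Sum>j\<in>F. c i * (cnj (c j) * l2_inner M (e i) (e j)))
      = (\<Sum>i\<in>F. \<Sum>j\<in>F. c i * (cnj (c j) * (if i = j then 1 else 0)))"
    by (intro sum.cong refl) (simp only: on)
  then have "complex_of_real ((l2_norm M (\<lambda>x. f x - (\<Sum>i\<in>F. c i * e i x)))\<^sup>2)
     = complex_of_real ((l2_norm M f)\<^sup>2 - (\<Sum>i\<in>F. (cmod (l2_inner M f (e i)))\<^sup>2)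
           + (\<Sum>i\<in>F. (cmod (c i - l2_inner M f (e i)))\<^sup>2))"
    by (simp only: l2_norm_diff_combination_power2[OF f e] l2_inner_self[of M f]
        complete_square_orthonormal[OF fin])
  then show ?thesis
    by (simp only: of_real_eq_iff)
qed

section \<open>Density of the continuous functions\<close>

locale compact_regular_prob_space = prob_space M for M :: "'x::t2_space measure" +
  assumes compact_UNIV: "compact (UNIV :: 'x set)"
    and regular: "regular_borel_measure M"
begin

lemma sets_eq_borel [measurable_cong]: "sets M = sets borel"
  using regular by (simp add: regular_borel_measure_def)

lemma space_eq_UNIV [simp]: "space M = UNIV"
  using sets_eq_imp_space_eq[OF sets_eq_borel] by simp

lemma continuous_measurable:
  fixes f :: "'x \<Rightarrow> 'b::topological_space"
  shows "continuous_on UNIV f \<Longrightarrow> f \<in> borel_measurable M"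
  using borel_measurable_continuous_onI[of f] measurable_cong_sets[OF sets_eq_borel refl] by blast

lemma continuous_bounded:
  fixes f :: "'x \<Rightarrow> complex"
  assumes "continuous_on UNIV f"
  shows "\<exists>C. \<forall>y. cmod (f y) \<le> C"
proof -
  have "bounded (range f)"
    using compact_continuous_image[OF assms compact_UNIV] by (rule compact_imp_bounded)
  then show ?thesis
    by (auto simp: bounded_iff)
qed

lemma continuous_sq_integrable:
  assumes "continuous_on UNIV f"
  shows "f \<in> sq_integrable M"
proof -
  obtain C where "\<forall>y. cmod (f y) \<le> C"
    using continuous_bounded[OF assms] by blast
  then show ?thesis
    by (intro bounded_sq_integrable[OF continuous_measurable[OF assms]]) auto
qed

lemma outer_regular:
  assumes S: "S \<in> sets borel" and "0 < \<delta>"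
  obtains U where "open U" "S \<subseteq> U" "prob U < prob S + \<delta>"
proof -
  have "emeasure M S = (INF U\<in>{U. open U \<and> S \<subseteq> U}. emeasure M U)"
    using regular S by (simp add: regular_borel_measure_def)
  moreover have "emeasure M S < ennreal (prob S + \<delta>)"
    using \<open>0 < \<delta>\<close> by (simp add: emeasure_eq_measure ennreal_lessI)
  ultimately obtain U where "open U" "S \<subseteq> U" "emeasure M U < ennreal (prob S + \<delta>)"
    by (auto simp: INF_less_iff)
  then show ?thesis
    using that by (auto simp: emeasure_eq_measure ennreal_less_iff)
qed

text \<open>Urysohn's lemma turns a closed set inside and an open set outside of a Borel set, of
  nearly the same measure, into a continuous function close to its indicator.\<close>

lemma indicator_approximable:
  assumes S: "S \<in> sets borel" and \<epsilon>: "0 < \<epsilon>"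
  obtains f :: "'x \<Rightarrow> complex"
    where "continuous_on UNIV f" "l2_norm M (\<lambda>x. indicator S x - f x) < \<epsilon>"
proof -
  \<comment> \<open>Approximating \<open>S\<close> and its complement from outside, up to \<open>\<delta>\<close> each, leaves an overlap of
    measure less than \<open>\<epsilon>\<^sup>2\<close>, and the indicator is met exactly outside of it.\<close>
  define \<delta> where "\<delta> = \<epsilon>\<^sup>2 / 2"
  have \<delta>: "0 < \<delta>"
    using \<epsilon> by (simp add: \<delta>_def)
  have S': "- S \<in> sets borel"
    using S by auto
  obtain U where U: "open U" "S \<subseteq> U" "prob U < prob S + \<delta>"
    using outer_regular[OF S \<delta>] .
  obtain V where V: "open V" "- S \<subseteq> V" "prob V < prob (- S) + \<delta>"
    using outer_regular[OF S' \<delta>] .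
  have [measurable]: "U \<in> sets M" "V \<in> sets M" "S \<in> sets M"
    using U V S by (auto simp: sets_eq_borel)
  have "normal_space (euclidean :: 'x topology)"
  proof (rule compact_Hausdorff_or_regular_imp_normal_space)
    show "compact_space (euclidean :: 'x topology)"
      using compact_UNIV by (simp add: compact_space_def)
    show "Hausdorff_space (euclidean :: 'x topology) \<or> regular_space (euclidean :: 'x topology)"
    proof (intro disjI1, unfold Hausdorff_space_def, intro allI impI)
      fix x y :: 'x
      assume "x \<in> topspace euclidean \<and> y \<in> topspace euclidean \<and> x \<noteq> y"
      then obtain U V where "open U" "open V" "x \<in> U" "y \<in> V" "U \<inter> V = {}"
        using hausdorff[of x y] by auto
      then show "\<exists>U V. openin euclidean U \<and> openin euclidean V \<and> x \<in> U \<and> y \<in> V \<and> disjnt U V"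
        by (auto simp: disjnt_def)
    qed
  qed
  moreover have "closedin euclidean (- U)" "closedin euclidean (- V)" "disjnt (- U) (- V)"
    using U V by (auto simp: disjnt_def)
  ultimately obtain g :: "'x \<Rightarrow> real" where g: "continuous_map euclidean (top_of_set {0..1}) g"
    "g ` (- U) \<subseteq> {0}" "g ` (- V) \<subseteq> {1}"
    using Urysohn_lemma[of euclidean "- U" "- V" 0 1] by auto
  have contg: "continuous_on UNIV g" and g01: "0 \<le> g x" "g x \<le> 1" for x
    using g(1) by (auto simp: continuous_map_in_subtopology)
  define f where "f x = complex_of_real (g x)" for x
  have contf: "continuous_on UNIV f"
    unfolding f_def using contg by (intro continuous_intros)
  have bound: "(cmod (indicator S x - f x))\<^sup>2 \<le> indicator (U \<inter> V) x" for x
  proof -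
    have "cmod (indicator S x - f x) = \<bar>indicator S x - g x\<bar>"
    proof -
      have "indicator S x - f x = complex_of_real (indicator S x - g x)"
        by (simp add: f_def indicator_def)
      then show ?thesis
        by (simp only: norm_of_real)
    qed
    moreover have "\<bar>indicator S x - g x\<bar> \<le> indicator (U \<inter> V) x"
      using g(2,3) g01[of x] U(2) V(2) by (auto simp: indicator_def)
    ultimately have "cmod (indicator S x - f x) \<le> indicator (U \<inter> V) x"
      by simp
    then have "(cmod (indicator S x - f x))\<^sup>2 \<le> (indicator (U \<inter> V) x)\<^sup>2"
      by (rule power_mono) simp
    also have "(indicator (U \<inter> V) x)\<^sup>2 = (indicator (U \<inter> V) x :: real)"
      by (simp add: indicator_def)
    finally show ?thesis .
  qed
  have "indicator S \<in> sq_integrable M"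
    by (rule bounded_sq_integrable[where C = 1]) (auto simp: indicator_def)
  then have "(\<lambda>x. indicator S x - f x) \<in> sq_integrable M"
    using continuous_sq_integrable[OF contf] by (rule sq_integrable_diff)
  then have "(LINT x|M. (cmod (indicator S x - f x))\<^sup>2) \<le> (LINT x|M. indicator (U \<inter> V) x)"
    by (intro integral_mono bound sq_integrable_integrable_square integrable_real_indicator)
      (auto simp: emeasure_eq_measure)
  also have "\<dots> = prob (U \<inter> V)"
    by simp
  also have "\<dots> < \<epsilon>\<^sup>2"
  proof -
    have "U \<union> V = UNIV"
      using U V by blast
    then have "prob U + prob V = 1 + prob (U \<inter> V)"
      using finite_measure_Union'[of U V] finite_measure_Diff'[of V U] prob_space
      by (simp add: Int_commute)
    moreover have "prob (- S) = 1 - prob S"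
      using prob_compl[of S] by (simp add: Compl_eq_Diff_UNIV)
    ultimately show ?thesis
      using U(3) V(3) by (simp add: \<delta>_def)
  qed
  finally have "l2_norm M (\<lambda>x. indicator S x - f x) < \<epsilon>"
    unfolding l2_norm_def using \<epsilon> by (simp add: real_less_lsqrt)
  then show ?thesis
    using that contf by blast
qed

lemma combination_approximable:
  assumes "finite F" and "\<And>i. i \<in> F \<Longrightarrow> e i \<in> sq_integrable M"
    and "\<And>i \<epsilon>::real. i \<in> F \<Longrightarrow> 0 < \<epsilon> \<Longrightarrow>
           \<exists>f. continuous_on UNIV f \<and> l2_norm M (\<lambda>x. e i x - f x) < \<epsilon>"
    and "0 < (\<epsilon>::real)"
  shows "\<exists>f. continuous_on UNIV f \<and> l2_norm M (\<lambda>x. (\<Sum>i\<in>F. c i * e i x) - f x) < \<epsilon>"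
  using assms
proof (induction F arbitrary: \<epsilon>)
  case empty
  then show ?case
    by (intro exI[of _ "\<lambda>x. 0"]) (simp add: l2_norm_def)
next
  case (insert i F)
  define \<eta> where "\<eta> = \<epsilon> / 2 / (1 + cmod (c i))"
  have "1 + cmod (c i) > 0"
    using norm_ge_zero[of "c i"] by linarith
  then have \<eta>: "0 < \<eta>"
    using \<open>0 < \<epsilon>\<close> by (simp add: \<eta>_def)
  have "(1 + cmod (c i)) * (\<epsilon> / 2 / (1 + cmod (c i))) = \<epsilon> / 2"
    unfolding times_divide_eq_right[of "1 + cmod (c i)" "\<epsilon> / 2"]
    by (rule nonzero_mult_div_cancel_left) (use \<open>1 + cmod (c i) > 0\<close> in simp)
  with \<eta>[unfolded \<eta>_def] have \<eta>': "cmod (c i) * \<eta> < \<epsilon> / 2"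
    unfolding \<eta>_def by (simp only: distrib_right mult_1_left)
  obtain f where f: "continuous_on UNIV f" "l2_norm M (\<lambda>x. e i x - f x) < \<eta>"
    using insert.prems(2)[OF _ \<eta>, of i] by auto
  obtain g where g: "continuous_on UNIV g" "l2_norm M (\<lambda>x. (\<Sum>i\<in>F. c i * e i x) - g x) < \<epsilon> / 2"
    using insert.IH[of "\<epsilon> / 2"] insert.prems by auto
  have "l2_norm M (\<lambda>x. c i * (e i x - f x)) \<le> cmod (c i) * \<eta>"
    unfolding l2_norm_scale using f(2) by (intro mult_left_mono) auto
  moreover have sq: "(\<lambda>x. e i x - f x) \<in> sq_integrable M"
    "(\<lambda>x. (\<Sum>i\<in>F. c i * e i x) - g x) \<in> sq_integrable M"
    using insert.prems(1) f(1) g(1)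
    by (simp_all add: sq_integrable_diff sq_integrable_combination continuous_sq_integrable)
  moreover note l2_norm_triangle[OF sq_integrable_scale[OF sq(1), of "c i"] sq(2)]
  ultimately have "l2_norm M (\<lambda>x. c i * (e i x - f x) + ((\<Sum>i\<in>F. c i * e i x) - g x)) < \<epsilon>"
    using \<eta>' g(2) by linarith
  then have "l2_norm M (\<lambda>x. (\<Sum>i\<in>insert i F. c i * e i x) - (c i * f x + g x)) < \<epsilon>"
    using insert.hyps by (simp add: algebra_simps)
  moreover have "continuous_on UNIV (\<lambda>x. c i * f x + g x)"
    using f g by (intro continuous_intros)
  ultimately show ?case
    by blast
qed

lemma sq_integrable_approximable_by_simple:
  assumes g: "g \<in> sq_integrable M" and \<epsilon>: "0 < \<epsilon>"
  obtains s where "simple_function M s" "l2_norm M (\<lambda>x. g x - s x) < \<epsilon>"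
proof -
  have gm [measurable]: "g \<in> borel_measurable M"
    using g by measurable
  obtain s where s: "\<And>i. simple_function M (s i)" "\<And>x. (\<lambda>i. s i x) \<longlonglongrightarrow> g x"
    "\<And>i x. cmod (s i x) \<le> 2 * cmod (g x)"
    using borel_measurable_implies_sequence_metric[OF gm, of 0]
    unfolding space_eq_UNIV dist_norm diff_0_right by blast
  have sm [measurable]: "s i \<in> borel_measurable M" for i
    using s(1) by (rule borel_measurable_simple_function)
  have "(\<lambda>i. LINT x|M. (cmod (g x - s i x))\<^sup>2) \<longlonglongrightarrow> (LINT x|M. 0)"
  proof (rule integral_dominated_convergence)
    show "integrable M (\<lambda>x. 9 * (cmod (g x))\<^sup>2)"
      using sq_integrable_integrable_square[OF g] by simp
    show "AE x in M. (\<lambda>i. (cmod (g x - s i x))\<^sup>2) \<longlonglongrightarrow> 0"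
    proof (rule AE_I2)
      fix x
      have "(\<lambda>i. (cmod (g x - s i x))\<^sup>2) \<longlonglongrightarrow> (cmod (g x - g x))\<^sup>2"
        by (intro tendsto_intros s)
      then show "(\<lambda>i. (cmod (g x - s i x))\<^sup>2) \<longlonglongrightarrow> 0"
        by simp
    qed
    \<comment> \<open>The simple functions are dominated by \<open>2 * cmod (g x)\<close>.\<close>
    have "(cmod (g x - s i x))\<^sup>2 \<le> (3 * cmod (g x))\<^sup>2" for i x
      using norm_triangle_ineq4[of "g x" "s i x"] s(3)[of i x] by (intro power_mono) auto
    then show "AE x in M. norm ((cmod (g x - s i x))\<^sup>2) \<le> 9 * (cmod (g x))\<^sup>2" for i
      by (auto simp: power_mult_distrib)
  qed measurable
  then have "(\<lambda>i. l2_norm M (\<lambda>x. g x - s i x)) \<longlonglongrightarrow> 0"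
    unfolding l2_norm_def by (auto dest: tendsto_real_sqrt)
  then have "\<forall>\<^sub>F i in sequentially. l2_norm M (\<lambda>x. g x - s i x) < \<epsilon>"
    using \<epsilon> by (rule order_tendstoD(2))
  then obtain i where "l2_norm M (\<lambda>x. g x - s i x) < \<epsilon>"
    using eventually_happens'[OF sequentially_bot] by blast
  then show ?thesis
    using that s(1) by blast
qed

lemma continuous_dense:
  assumes g: "g \<in> sq_integrable M" and \<epsilon>: "0 < \<epsilon>"
  obtains f where "continuous_on UNIV f" "l2_norm M (\<lambda>x. g x - f x) < \<epsilon>"
proof -
  obtain s where s: "simple_function M s" "l2_norm M (\<lambda>x. g x - s x) < \<epsilon> / 2"
    using sq_integrable_approximable_by_simple[OF g half_gt_zero[OF \<epsilon>]] .
  have s_eq: "s = (\<lambda>x. \<Sum>y\<in>range s. y * indicator (s -` {y}) x)"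
  proof (rule ext)
    fix x
    have "s x = (\<Sum>y\<in>range s. indicator (s -` {y}) x *\<^sub>R y)"
      by (rule simple_function_indicator_representation_banach[OF s(1), of x,
            unfolded space_eq_UNIV Int_UNIV_right, OF UNIV_I])
    also have "\<dots> = (\<Sum>y\<in>range s. y * indicator (s -` {y}) x)"
      by (intro sum.cong refl) (simp add: indicator_def)
    finally show "s x = (\<Sum>y\<in>range s. y * indicator (s -` {y}) x)" .
  qed
  have fin: "finite (range s)"
    using simple_functionD(1)[OF s(1)] by simp
  have pre: "s -` {y} \<in> sets borel" for y
    using simple_functionD(2)[OF s(1), of "{y}"] by (simp add: sets_eq_borel)
  then have sq: "indicator (s -` {y}) \<in> sq_integrable M" for y
    by (intro bounded_sq_integrable[where C = 1]) (auto simp: sets_eq_borel indicator_def)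
  have "\<exists>f. continuous_on UNIV f \<and>
          l2_norm M (\<lambda>x. (\<Sum>y\<in>range s. y * indicator (s -` {y}) x) - f x) < \<epsilon> / 2"
  proof (rule combination_approximable[OF fin])
    show "\<exists>f. continuous_on UNIV f \<and> l2_norm M (\<lambda>x. indicator (s -` {y}) x - f x) < \<eta>"
      if "0 < \<eta>" for y and \<eta> :: real
      by (rule indicator_approximable[OF pre that]) blast
  qed (use sq \<epsilon> in auto)
  then obtain f where f: "continuous_on UNIV f" "l2_norm M (\<lambda>x. s x - f x) < \<epsilon> / 2"
    unfolding fun_cong[OF s_eq, symmetric] by blast
  have "s \<in> sq_integrable M"
    by (subst s_eq) (intro sq_integrable_combination sq)
  then have "l2_norm M (\<lambda>x. g x - f x) < \<epsilon>"
    using l2_norm_diff_triangle[OF g _ continuous_sq_integrable[OF f(1)], of s] s(2) f(2) by simp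
  then show ?thesis
    using that f(1) by blast
qed

end

section \<open>Means along a Folner sequence\<close>

lemma dual_group_continuous: "\<gamma> \<in> dual_group \<Longrightarrow> continuous_on UNIV \<gamma>"
  and dual_group_add: "\<gamma> \<in> dual_group \<Longrightarrow> \<gamma> (s + t) = \<gamma> s * \<gamma> t"
  and dual_group_norm: "\<gamma> \<in> dual_group \<Longrightarrow> cmod (\<gamma> t) = 1"
  by (auto simp: dual_group_def)

lemma dual_group_mult_cnj:
  assumes "\<gamma> \<in> dual_group"
  shows "\<gamma> t * cnj (\<gamma> t) = 1"
  using complex_norm_square[of "\<gamma> t"] by (simp add: dual_group_norm[OF assms])

lemma dual_group_mult_cnj_mem:
  assumes "\<gamma> \<in> dual_group" and "\<gamma>' \<in> dual_group"
  shows "(\<lambda>t. \<gamma> t * cnj (\<gamma>' t)) \<in> dual_group"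
proof -
  have "continuous_on UNIV (\<lambda>t. \<gamma> t * cnj (\<gamma>' t))"
    by (intro continuous_on_mult continuous_on_cnj dual_group_continuous assms)
  then show ?thesis
    using assms unfolding dual_group_def by (simp add: norm_mult)
qed

locale folner =
  fixes \<mu> :: "'g::{topological_ab_group_add, t2_space} measure" and A :: "nat \<Rightarrow> 'g set"
  assumes haar: "haar_measure \<mu>" and folner: "folner_sequence \<mu> A"
begin

lemma sets_eq_borel [measurable_cong]: "sets \<mu> = sets borel"
  using haar by (simp add: haar_measure_def regular_borel_measure_def)

lemma compact_finite:
  assumes "compact K"
  shows "emeasure \<mu> K < \<infinity>"
proof -
  have "\<forall>K. compact K \<longrightarrow> emeasure \<mu> K < \<infinity>"
    using haar unfolding haar_measure_def regular_borel_measure_def by (elim conjE)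
  then show ?thesis
    using assms by blast
qed

lemma emeasure_translate: "S \<in> sets \<mu> \<Longrightarrow> emeasure \<mu> ((+) t ` S) = emeasure \<mu> S"
  using haar unfolding haar_measure_def sets_eq_borel by (elim conjE) blast

lemma space_eq_UNIV [simp]: "space \<mu> = UNIV"
  using sets_eq_imp_space_eq[OF sets_eq_borel] by simp

lemma continuous_measurable:
  fixes h :: "'g \<Rightarrow> 'b::topological_space"
  shows "continuous_on UNIV h \<Longrightarrow> h \<in> borel_measurable \<mu>"
  using borel_measurable_continuous_onI[of h] measurable_cong_sets[OF sets_eq_borel refl] by blast

lemma translate_eq_vimage: "(+) t ` S = (+) (- t) -` (S :: 'g set)"
proof (intro set_eqI iffI)
  fix y assume "y \<in> (+) (- t) -` S"
  then show "y \<in> (+) t ` S"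
    by (intro image_eqI[of _ _ "- t + y"]) auto
qed auto

lemma measurable_translation [measurable]: "(+) t \<in> \<mu> \<rightarrow>\<^sub>M \<mu>"
proof -
  have "(+) t \<in> borel_measurable borel"
    by (intro borel_measurable_continuous_onI continuous_intros)
  then show ?thesis
    using measurable_cong_sets[OF sets_eq_borel sets_eq_borel] by blast
qed

lemma translate_sets: "S \<in> sets \<mu> \<Longrightarrow> (+) t ` S \<in> sets \<mu>"
  using measurable_sets[OF measurable_translation[of "- t"]] by (simp add: translate_eq_vimage)

lemma distr_translation: "distr \<mu> \<mu> ((+) t) = \<mu>"
proof (rule measure_eqI)
  fix S assume "S \<in> sets (distr \<mu> \<mu> ((+) t))"
  then have S: "S \<in> sets \<mu>"
    by simp
  have "emeasure (distr \<mu> \<mu> ((+) t)) S = emeasure \<mu> ((+) (- t) ` S)"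
    using S by (subst emeasure_distr) (simp_all only: translate_eq_vimage[of "- t"] minus_minus
        space_eq_UNIV Int_UNIV_right measurable_translation)
  also have "\<dots> = emeasure \<mu> S"
    using S by (rule emeasure_translate)
  finally show "emeasure (distr \<mu> \<mu> ((+) t)) S = emeasure \<mu> S" .
qed simp

lemma A_sets [measurable]: "A n \<in> sets \<mu>"
  using folner by (simp add: folner_sequence_def sets_eq_borel)

lemma A_pos: "0 < measure \<mu> (A n)"
  using folner by (simp add: folner_sequence_def)

lemma A_finite: "emeasure \<mu> (A n) < \<infinity>"
proof -
  have "compact (closure (A n))"
    using folner by (simp add: folner_sequence_def)
  then have "emeasure \<mu> (closure (A n)) < \<infinity>"
    by (rule compact_finite)
  moreover have "emeasure \<mu> (A n) \<le> emeasure \<mu> (closure (A n))"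
    by (rule emeasure_mono) (auto simp: sets_eq_borel closure_subset)
  ultimately show ?thesis
    by (rule le_less_trans[rotated])
qed

lemma translate_A_finite: "emeasure \<mu> ((+) t ` A n) < \<infinity>"
  by (simp only: emeasure_translate[OF A_sets] A_finite)

text \<open>Normalising the Haar measure on \<open>A n\<close> to a probability measure makes means of functions on
  the group into inner products, and the Besicovitch seminorm into an upper limit of
  \<open>L\<^sup>2\<close> norms.\<close>

definition P :: "nat \<Rightarrow> 'g measure" where
  "P n = uniform_measure \<mu> (A n)"

lemma prob_space_P: "prob_space (P n)"
proof -
  have "emeasure \<mu> (A n) \<noteq> 0"
    using A_pos[of n] by (auto simp: measure_def)
  then show ?thesis
    unfolding P_def using A_finite[of n] by (intro prob_space_uniform_measure) auto
qed

lemma sets_P [measurable_cong]: "sets (P n) = sets \<mu>"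
  by (simp add: P_def)

lemma measurable_P: "h \<in> borel_measurable \<mu> \<Longrightarrow> h \<in> borel_measurable (P n)"
  using measurable_cong_sets[OF sets_P refl] by blast

lemma integral_P:
  fixes h :: "'g \<Rightarrow> 'b::{banach, second_countable_topology}"
  assumes "h \<in> borel_measurable \<mu>"
  shows "integral\<^sup>L (P n) h = average \<mu> (A n) h"
proof -
  have "P n = density \<mu> (\<lambda>t. ennreal (indicator (A n) t / measure \<mu> (A n)))"
  proof -
    have "emeasure \<mu> (A n) = ennreal (measure \<mu> (A n))"
      by (rule emeasure_eq_ennreal_measure) (use A_finite[of n] in simp)
    then have "indicator (A n) t / emeasure \<mu> (A n) = ennreal (indicator (A n) t / measure \<mu> (A n))" for t
      using A_pos[of n] by (simp only: ennreal_indicator[symmetric] divide_ennreal indicator_pos_le)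
    then show ?thesis
      unfolding P_def uniform_measure_def by simp
  qed
  then have "integral\<^sup>L (P n) h = (LINT t|\<mu>. (indicator (A n) t / measure \<mu> (A n)) *\<^sub>R h t)"
    using assms by (simp add: integral_density)
  also have "\<dots> = (LINT t|\<mu>. (1 / measure \<mu> (A n)) *\<^sub>R (indicator (A n) t *\<^sub>R h t))"
    by simp
  also have "\<dots> = average \<mu> (A n) h"
    unfolding average_def set_lebesgue_integral_def by (rule integral_scaleR_right)
  finally show ?thesis .
qed

lemma bounded_sq_integrable_P:
  assumes "h \<in> borel_measurable \<mu>" and "\<And>t. cmod (h t) \<le> C"
  shows "h \<in> sq_integrable (P n)"
proof -
  interpret P: prob_space "P n"
    by (rule prob_space_P)
  show ?thesis
    using assms measurable_P by (intro P.bounded_sq_integrable) auto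
qed

lemma dual_group_sq_integrable_P:
  assumes "\<gamma> \<in> dual_group"
  shows "\<gamma> \<in> sq_integrable (P n)"
  by (intro bounded_sq_integrable_P[where C = 1] continuous_measurable dual_group_continuous assms)
    (simp add: dual_group_norm[OF assms])

lemma average_mult_cnj:
  assumes "h \<in> borel_measurable \<mu>" and "k \<in> borel_measurable \<mu>"
  shows "average \<mu> (A n) (\<lambda>t. h t * cnj (k t)) = l2_inner (P n) h k"
  unfolding l2_inner_def by (rule integral_P[symmetric]) (use assms in measurable)

lemma besicovitch_seminorm_eq:
  assumes [measurable]: "h \<in> borel_measurable \<mu>"
  shows "besicovitch_seminorm \<mu> A h = limsup (\<lambda>n. ereal (l2_norm (P n) h))"
proof -
  have "average \<mu> (A n) (\<lambda>t. (cmod (h t))\<^sup>2) = (LINT t|P n. (cmod (h t))\<^sup>2)" for n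
    by (rule integral_P[symmetric]) measurable
  then show ?thesis
    unfolding besicovitch_seminorm_def l2_norm_def by simp
qed

subsection \<open>Asymptotic invariance\<close>

text \<open>Invariance of the Haar measure moves the translation from the integrand to the set \<open>A n\<close>; the two
  integrals then differ only over the symmetric difference of \<open>A n\<close> and its translate.\<close>

lemma average_shift_diff_bound:
  fixes k :: "'g \<Rightarrow> complex"
  assumes k [measurable]: "k \<in> borel_measurable \<mu>" and C: "\<And>t. cmod (k t) \<le> C"
  shows "cmod (average \<mu> (A n) (\<lambda>t. k (s + t)) - average \<mu> (A n) k)
       \<le> C * (measure \<mu> (sym_diff (A n) ((+) s ` A n)) / measure \<mu> (A n))"
proof -
  have B [measurable]: "(+) s ` A n \<in> sets \<mu>"
    by (rule translate_sets) simp
  have ks [measurable]: "(\<lambda>t. k (s + t)) \<in> borel_measurable \<mu>"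
    using measurable_compose[OF measurable_translation k] .
  have "0 \<le> C"
    by (rule order_trans[OF norm_ge_zero C[of 0]])
  have bdd: "integrable \<mu> (\<lambda>t. indicator S t *\<^sub>R k t)" if "S \<in> sets \<mu>" "emeasure \<mu> S < \<infinity>" for S
  proof (rule Bochner_Integration.integrable_bound)
    show "integrable \<mu> (\<lambda>t. C * indicator S t)"
      using that by simp
    show "(\<lambda>t. indicator S t *\<^sub>R k t) \<in> borel_measurable \<mu>"
      using that by measurable
    show "AE t in \<mu>. norm (indicator S t *\<^sub>R k t) \<le> norm (C * indicator S t)"
      using C \<open>0 \<le> C\<close> by (auto simp: indicator_def)
  qed
  have "(LINT t:A n|\<mu>. k (s + t)) = (LINT t|\<mu>. indicator ((+) s ` A n) (s + t) *\<^sub>R k (s + t))"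
    unfolding set_lebesgue_integral_def
    by (rule Bochner_Integration.integral_cong) (auto simp: indicator_def)
  also have "\<dots> = (LINT t|distr \<mu> \<mu> ((+) s). indicator ((+) s ` A n) t *\<^sub>R k t)"
    by (rule integral_distr[symmetric]) measurable
  also have "\<dots> = (LINT t|\<mu>. indicator ((+) s ` A n) t *\<^sub>R k t)"
    by (simp only: distr_translation)
  finally have "(LINT t:A n|\<mu>. k (s + t)) - (LINT t:A n|\<mu>. k t)
      = (LINT t|\<mu>. indicator ((+) s ` A n) t *\<^sub>R k t - indicator (A n) t *\<^sub>R k t)"
    unfolding set_lebesgue_integral_def
    by (subst Bochner_Integration.integral_diff) (auto intro: bdd A_finite translate_A_finite)
  also have "cmod \<dots> \<le> (LINT t|\<mu>. C * indicator (sym_diff (A n) ((+) s ` A n)) t)"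
  proof (rule order_trans[OF integral_norm_bound], rule integral_mono)
    show "integrable \<mu> (\<lambda>t. cmod (indicator ((+) s ` A n) t *\<^sub>R k t - indicator (A n) t *\<^sub>R k t))"
      by (intro integrable_norm Bochner_Integration.integrable_diff bdd A_finite translate_A_finite) auto
    have "emeasure \<mu> (sym_diff (A n) ((+) s ` A n)) \<le> emeasure \<mu> (A n) + emeasure \<mu> ((+) s ` A n)"
      by (rule order_trans[OF emeasure_mono emeasure_subadditive]) auto
    also have "\<dots> < \<infinity>"
      using A_finite translate_A_finite by simp
    finally show "integrable \<mu> (\<lambda>t. C * indicator (sym_diff (A n) ((+) s ` A n)) t)"
      by (intro integrable_mult_right integrable_real_indicator) auto
    show "cmod (indicator ((+) s ` A n) t *\<^sub>R k t - indicator (A n) t *\<^sub>R k t)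
            \<le> C * indicator (sym_diff (A n) ((+) s ` A n)) t" for t
      using C[of t] by (auto simp: indicator_def)
  qed
  also have "\<dots> = C * measure \<mu> (sym_diff (A n) ((+) s ` A n))"
    by simp
  finally have "cmod ((LINT t:A n|\<mu>. k (s + t)) - (LINT t:A n|\<mu>. k t))
      \<le> C * measure \<mu> (sym_diff (A n) ((+) s ` A n))" .
  moreover have "cmod (average \<mu> (A n) (\<lambda>t. k (s + t)) - average \<mu> (A n) k)
      = cmod ((LINT t:A n|\<mu>. k (s + t)) - (LINT t:A n|\<mu>. k t)) / measure \<mu> (A n)"
    unfolding average_def scaleR_diff_right[symmetric] norm_scaleR using A_pos[of n] by simp
  ultimately show ?thesis
    using A_pos[of n] by (simp add: divide_right_mono)
qed

lemma average_shift:
  fixes k :: "'g \<Rightarrow> complex"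
  assumes "k \<in> borel_measurable \<mu>" and "\<And>t. cmod (k t) \<le> C"
  shows "(\<lambda>n. average \<mu> (A n) (\<lambda>t. k (s + t)) - average \<mu> (A n) k) \<longlonglongrightarrow> 0"
proof (rule Lim_null_comparison)
  show "\<forall>\<^sub>F n in sequentially. cmod (average \<mu> (A n) (\<lambda>t. k (s + t)) - average \<mu> (A n) k)
       \<le> C * (measure \<mu> (sym_diff (A n) ((+) s ` A n)) / measure \<mu> (A n))"
    using average_shift_diff_bound[OF assms] by simp
  have "(\<lambda>n. measure \<mu> (sym_diff (A n) ((+) s ` A n)) / measure \<mu> (A n)) \<longlonglongrightarrow> 0"
    using folner by (simp add: folner_sequence_def)
  then show "(\<lambda>n. C * (measure \<mu> (sym_diff (A n) ((+) s ` A n)) / measure \<mu> (A n))) \<longlonglongrightarrow> 0"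
    by (rule tendsto_mult_right_zero)
qed

lemma average_scale: "average \<mu> S (\<lambda>t. c * h t) = c * average \<mu> S (h :: 'g \<Rightarrow> complex)"
  by (simp add: average_def set_lebesgue_integral_def scaleR_conv_of_real mult.left_commute)

text \<open>A character \<open>\<gamma>\<close> multiplies its own mean by \<open>\<gamma> s\<close> under translation by \<open>s\<close>, which is
  asymptotically invisible; so the mean vanishes unless \<open>\<gamma>\<close> is trivial.\<close>

lemma average_nontrivial_character:
  assumes \<gamma>: "\<gamma> \<in> dual_group" and "\<gamma> s \<noteq> 1"
  shows "(\<lambda>n. average \<mu> (A n) \<gamma>) \<longlonglongrightarrow> 0"
proof -
  have "(\<lambda>n. average \<mu> (A n) (\<lambda>t. \<gamma> (s + t)) - average \<mu> (A n) \<gamma>) \<longlonglongrightarrow> 0"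
    by (intro average_shift[where C = 1] continuous_measurable dual_group_continuous \<gamma>)
      (simp add: dual_group_norm[OF \<gamma>])
  moreover have "average \<mu> (A n) (\<lambda>t. \<gamma> (s + t)) - average \<mu> (A n) \<gamma>
      = (\<gamma> s - 1) * average \<mu> (A n) \<gamma>" for n
    by (simp add: dual_group_add[OF \<gamma>] average_scale left_diff_distrib)
  ultimately have "(\<lambda>n. (\<gamma> s - 1) * average \<mu> (A n) \<gamma>) \<longlonglongrightarrow> 0"
    by simp
  then have "(\<lambda>n. (\<gamma> s - 1) * average \<mu> (A n) \<gamma> / (\<gamma> s - 1)) \<longlonglongrightarrow> 0 / (\<gamma> s - 1)"
    using assms(2) by (intro tendsto_divide) auto
  then show ?thesis
    using assms(2) by simp
qed

lemma characters_asymptotically_orthonormal: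
  assumes \<gamma>: "\<gamma> \<in> dual_group" and \<gamma>': "\<gamma>' \<in> dual_group"
  shows "(\<lambda>n. l2_inner (P n) \<gamma> \<gamma>') \<longlonglongrightarrow> (if \<gamma> = \<gamma>' then 1 else 0)"
proof (cases "\<gamma> = \<gamma>'")
  case True
  have "l2_inner (P n) \<gamma> \<gamma> = 1" for n
  proof -
    interpret P: prob_space "P n"
      by (rule prob_space_P)
    show ?thesis
      by (simp add: l2_inner_def dual_group_mult_cnj[OF \<gamma>] P.prob_space)
  qed
  then show ?thesis
    using True by simp
next
  case False
  then obtain s where "\<gamma> s \<noteq> \<gamma>' s"
    by blast
  moreover have "\<gamma> s = \<gamma>' s" if "\<gamma> s * cnj (\<gamma>' s) = 1"
  proof -
    have "\<gamma> s = \<gamma> s * (\<gamma>' s * cnj (\<gamma>' s))"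
      unfolding dual_group_mult_cnj[OF \<gamma>'] by simp
    also have "\<dots> = (\<gamma> s * cnj (\<gamma>' s)) * \<gamma>' s"
      by (simp only: mult_ac)
    finally show ?thesis
      unfolding that by simp
  qed
  ultimately have "\<gamma> s * cnj (\<gamma>' s) \<noteq> 1"
    by blast
  from average_nontrivial_character[OF dual_group_mult_cnj_mem[OF \<gamma> \<gamma>'], of s, OF this]
  show ?thesis
    using False by (simp add: average_mult_cnj continuous_measurable dual_group_continuous \<gamma> \<gamma>')
qed

subsection \<open>Besicovitch almost periodic functions\<close>

text \<open>In the limit, the means treat the characters as an orthonormal family, which gives the same
  expansion as in \<open>L\<^sup>2\<close>. It is used in both directions: for \<open>c = a\<close> the last sum vanishes, so
  Fourier polynomials approximate well once the coefficients carry almost all of \<open>N\<close>; and since the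
  last sum is never negative, an approximation with any \<open>c\<close> shows that they do.\<close>

lemma trigonometric_distance_limit:
  assumes h: "h \<in> borel_measurable \<mu>" "\<And>t. cmod (h t) \<le> C"
    and F: "finite F" "F \<subseteq> dual_group"
    and a: "\<And>\<gamma>. \<gamma> \<in> F \<Longrightarrow> (\<lambda>n. l2_inner (P n) h \<gamma>) \<longlonglongrightarrow> a \<gamma>"
    and N: "(\<lambda>n. (l2_norm (P n) h)\<^sup>2) \<longlonglongrightarrow> N"
  shows "(\<lambda>n. (l2_norm (P n) (\<lambda>t. h t - (\<Sum>\<gamma>\<in>F. c \<gamma> * \<gamma> t)))\<^sup>2) \<longlonglongrightarrow>
           N - (\<Sum>\<gamma>\<in>F. (cmod (a \<gamma>))\<^sup>2) + (\<Sum>\<gamma>\<in>F. (cmod (c \<gamma> - a \<gamma>))\<^sup>2)"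
proof -
  have expand: "complex_of_real ((l2_norm (P n) (\<lambda>t. h t - (\<Sum>\<gamma>\<in>F. c \<gamma> * \<gamma> t)))\<^sup>2)
       = complex_of_real ((l2_norm (P n) h)\<^sup>2) - (\<Sum>\<gamma>\<in>F. cnj (c \<gamma>) * l2_inner (P n) h \<gamma>)
           - cnj (\<Sum>\<gamma>\<in>F. cnj (c \<gamma>) * l2_inner (P n) h \<gamma>)
           + (\<Sum>\<gamma>\<in>F. \<Sum>\<gamma>'\<in>F. c \<gamma> * (cnj (c \<gamma>') * l2_inner (P n) \<gamma> \<gamma>'))" for n
    using bounded_sq_integrable_P[OF h] dual_group_sq_integrable_P F(2)
    unfolding l2_inner_self[symmetric, of _ h]
    by (intro l2_norm_diff_combination_power2[where e = "\<lambda>\<gamma>. \<gamma>"]) auto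
  have "(\<lambda>n. complex_of_real ((l2_norm (P n) (\<lambda>t. h t - (\<Sum>\<gamma>\<in>F. c \<gamma> * \<gamma> t)))\<^sup>2)) \<longlonglongrightarrow>
      complex_of_real N - (\<Sum>\<gamma>\<in>F. cnj (c \<gamma>) * a \<gamma>) - cnj (\<Sum>\<gamma>\<in>F. cnj (c \<gamma>) * a \<gamma>)
       + (\<Sum>\<gamma>\<in>F. \<Sum>\<gamma>'\<in>F. c \<gamma> * (cnj (c \<gamma>') * (if \<gamma> = \<gamma>' then 1 else 0)))"
    unfolding expand using F(2)
    by (intro tendsto_add tendsto_diff tendsto_cnj tendsto_sum tendsto_mult tendsto_const
        tendsto_of_real N a characters_asymptotically_orthonormal) auto
  then show ?thesis
    unfolding complete_square_orthonormal[OF F(1)] tendsto_of_real_iff .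
qed

lemma trigonometric_polynomial_measurable:
  assumes "F \<subseteq> dual_group"
  shows "(\<lambda>t. \<Sum>\<gamma>\<in>F. c \<gamma> * \<gamma> t) \<in> borel_measurable \<mu>"
  using assms by (intro borel_measurable_sum borel_measurable_times borel_measurable_const
      continuous_measurable dual_group_continuous) auto

lemma trigonometric_polynomial_sq_integrable:
  assumes "F \<subseteq> dual_group"
  shows "(\<lambda>t. \<Sum>\<gamma>\<in>F. c \<gamma> * \<gamma> t) \<in> sq_integrable (P n)"
  using assms by (intro sq_integrable_combination[where e = "\<lambda>\<gamma>. \<gamma>"] dual_group_sq_integrable_P) auto

text \<open>The approximating trigonometric polynomials are the Fourier polynomials.\<close>

lemma besicovitch_ap_functionI:
  assumes h: "h \<in> borel_measurable \<mu>" "\<And>t. cmod (h t) \<le> C"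
    and a: "\<And>\<gamma>. \<gamma> \<in> S \<Longrightarrow> (\<lambda>n. l2_inner (P n) h \<gamma>) \<longlonglongrightarrow> a \<gamma>"
    and S: "S \<subseteq> dual_group"
    and N: "(\<lambda>n. (l2_norm (P n) h)\<^sup>2) \<longlonglongrightarrow> N"
    and parseval: "\<And>\<epsilon>. 0 < \<epsilon> \<Longrightarrow> \<exists>F\<subseteq>S. finite F \<and> N - (\<Sum>\<gamma>\<in>F. (cmod (a \<gamma>))\<^sup>2) < \<epsilon>"
  shows "besicovitch_ap_function \<mu> A h"
  unfolding besicovitch_ap_function_def
proof (intro conjI allI impI)
  show "h \<in> borel_measurable \<mu>"
    by (rule h)
  show "bounded (range h)"
    using h(2) by (auto simp: bounded_iff)
  fix \<epsilon> :: real assume "0 < \<epsilon>"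
  then obtain F where F: "F \<subseteq> S" "finite F" "N - (\<Sum>\<gamma>\<in>F. (cmod (a \<gamma>))\<^sup>2) < \<epsilon>\<^sup>2"
    using parseval[of "\<epsilon>\<^sup>2"] by auto
  have Fd: "F \<subseteq> dual_group"
    using F S by blast
  define p where "p t = (\<Sum>\<gamma>\<in>F. a \<gamma> * \<gamma> t)" for t
  have "(\<lambda>n. (l2_norm (P n) (\<lambda>t. h t - p t))\<^sup>2) \<longlonglongrightarrow> N - (\<Sum>\<gamma>\<in>F. (cmod (a \<gamma>))\<^sup>2)"
    unfolding p_def using trigonometric_distance_limit[OF h F(2) Fd a N, of a] F(1) by auto
  then have "\<forall>\<^sub>F n in sequentially. (l2_norm (P n) (\<lambda>t. h t - p t))\<^sup>2 < \<epsilon>\<^sup>2"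
    using F(3) by (rule order_tendstoD(2))
  then have "\<forall>\<^sub>F n in sequentially. ereal (l2_norm (P n) (\<lambda>t. h t - p t)) \<le> ereal \<epsilon>"
    by eventually_elim (use \<open>0 < \<epsilon>\<close> in \<open>auto intro: less_imp_le power2_less_imp_less\<close>)
  then have "limsup (\<lambda>n. ereal (l2_norm (P n) (\<lambda>t. h t - p t))) \<le> ereal \<epsilon>"
    by (rule Limsup_bounded)
  moreover have "(\<lambda>t. h t - p t) \<in> borel_measurable \<mu>"
    unfolding p_def by (intro borel_measurable_diff h trigonometric_polynomial_measurable Fd)
  ultimately have "besicovitch_seminorm \<mu> A (\<lambda>t. h t - p t) \<le> ereal \<epsilon>"
    by (simp add: besicovitch_seminorm_eq)
  moreover have "p \<in> lin_combs dual_group"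
    unfolding p_def lin_combs_def using F(2) Fd by blast
  ultimately show "\<exists>p\<in>lin_combs dual_group. besicovitch_seminorm \<mu> A (\<lambda>t. h t - p t) \<le> ereal \<epsilon>"
    by blast
qed

lemma besicovitch_ap_function_approximation:
  assumes h: "besicovitch_ap_function \<mu> A h" and "0 < \<epsilon>"
  obtains F c where "finite F" "F \<subseteq> dual_group"
    "\<forall>\<^sub>F n in sequentially. l2_norm (P n) (\<lambda>t. h t - (\<Sum>\<gamma>\<in>F. c \<gamma> * \<gamma> t)) < \<epsilon>"
proof -
  obtain p where p: "p \<in> lin_combs dual_group"
    "besicovitch_seminorm \<mu> A (\<lambda>t. h t - p t) \<le> ereal (\<epsilon> / 2)"
    using h \<open>0 < \<epsilon>\<close> unfolding besicovitch_ap_function_def by (meson half_gt_zero)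
  obtain F c where F: "finite F" "F \<subseteq> dual_group" and p_eq: "p = (\<lambda>t. \<Sum>\<gamma>\<in>F. c \<gamma> * \<gamma> t)"
    using p(1) unfolding lin_combs_def by blast
  have "h \<in> borel_measurable \<mu>"
    using h by (simp add: besicovitch_ap_function_def)
  then have "(\<lambda>t. h t - p t) \<in> borel_measurable \<mu>"
    unfolding p_eq by (intro borel_measurable_diff trigonometric_polynomial_measurable F)
  then have "limsup (\<lambda>n. ereal (l2_norm (P n) (\<lambda>t. h t - p t))) \<le> ereal (\<epsilon> / 2)"
    using p(2) by (simp add: besicovitch_seminorm_eq)
  also have "\<dots> < ereal \<epsilon>"
    using \<open>0 < \<epsilon>\<close> by simp
  finally have "\<forall>\<^sub>F n in sequentially. ereal (l2_norm (P n) (\<lambda>t. h t - p t)) < ereal \<epsilon>"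
    by (rule Limsup_lessD)
  then show ?thesis
    using that F unfolding p_eq by simp
qed

lemma l2_inner_character_bound:
  assumes "h \<in> sq_integrable (P n)" and "\<gamma> \<in> dual_group"
  shows "cmod (l2_inner (P n) h \<gamma>) \<le> l2_norm (P n) h"
proof -
  interpret P: prob_space "P n"
    by (rule prob_space_P)
  have "l2_norm (P n) \<gamma> = 1"
    by (simp add: l2_norm_def dual_group_norm[OF assms(2)] P.prob_space)
  then show ?thesis
    using l2_cauchy_schwarz[OF assms(1) dual_group_sq_integrable_P[OF assms(2)]] by simp
qed

lemma besicovitch_ap_function_sq_integrable:
  assumes "besicovitch_ap_function \<mu> A h"
  shows "h \<in> sq_integrable (P n)"
proof -
  obtain C where "\<forall>z\<in>range h. cmod z \<le> C"
    using assms unfolding besicovitch_ap_function_def bounded_iff by blast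
  then show ?thesis
    using assms by (intro bounded_sq_integrable_P[of h C]) (auto simp: besicovitch_ap_function_def)
qed

text \<open>Fourier coefficients of trigonometric polynomials exist by asymptotic orthonormality, and
  approximation in the Besicovitch seminorm moves the means by little.\<close>

lemma besicovitch_ap_function_coefficient_exists:
  assumes h: "besicovitch_ap_function \<mu> A h" and \<gamma>: "\<gamma> \<in> dual_group"
  shows "convergent (\<lambda>n. l2_inner (P n) h \<gamma>)"
proof -
  have "Cauchy (\<lambda>n. l2_inner (P n) h \<gamma>)"
  proof (rule metric_CauchyI)
    fix e :: real assume "0 < e"
    then have e3: "0 < e / 3"
      by simp
    obtain F c where F: "finite F" "F \<subseteq> dual_group"
      and ev: "\<forall>\<^sub>F n in sequentially. l2_norm (P n) (\<lambda>t. h t - (\<Sum>\<gamma>\<in>F. c \<gamma> * \<gamma> t)) < e / 3"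
      using besicovitch_ap_function_approximation[OF h e3] .
    define p where "p t = (\<Sum>\<gamma>\<in>F. c \<gamma> * \<gamma> t)" for t
    have psq: "p \<in> sq_integrable (P n)" for n
      unfolding p_def by (rule trigonometric_polynomial_sq_integrable[OF F(2)])
    have p_inner: "l2_inner (P n) p \<gamma> = (\<Sum>\<beta>\<in>F. c \<beta> * l2_inner (P n) \<beta> \<gamma>)" for n
      unfolding p_def using F(2) \<gamma>
      by (intro l2_inner_combination_left[where e = "\<lambda>\<gamma>. \<gamma>"] dual_group_sq_integrable_P) auto
    have "convergent (\<lambda>n. l2_inner (P n) p \<gamma>)"
      unfolding p_inner using F(2) \<gamma> characters_asymptotically_orthonormal
      by (intro convergent_sum convergent_mult convergent_const) (auto simp: convergent_def)
    then have "Cauchy (\<lambda>n. l2_inner (P n) p \<gamma>)"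
      by (rule convergent_Cauchy)
    then obtain N1 where N1: "\<And>i j. i \<ge> N1 \<Longrightarrow> j \<ge> N1 \<Longrightarrow>
        dist (l2_inner (P i) p \<gamma>) (l2_inner (P j) p \<gamma>) < e / 3"
      using e3 metric_CauchyD by blast
    obtain N2 where N2: "\<And>n. n \<ge> N2 \<Longrightarrow> l2_norm (P n) (\<lambda>t. h t - p t) < e / 3"
      using ev unfolding p_def eventually_sequentially by blast
    have close: "dist (l2_inner (P n) h \<gamma>) (l2_inner (P n) p \<gamma>) < e / 3" if "n \<ge> N2" for n
    proof -
      have hsq: "h \<in> sq_integrable (P n)"
        by (rule besicovitch_ap_function_sq_integrable[OF h])
      have "dist (l2_inner (P n) h \<gamma>) (l2_inner (P n) p \<gamma>) = cmod (l2_inner (P n) (\<lambda>t. h t - p t) \<gamma>)"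
        unfolding dist_norm by (subst l2_inner_diff_left[OF hsq psq dual_group_sq_integrable_P[OF \<gamma>]]) simp
      also have "\<dots> \<le> l2_norm (P n) (\<lambda>t. h t - p t)"
        by (intro l2_inner_character_bound sq_integrable_diff hsq psq \<gamma>)
      finally show ?thesis
        using N2[OF that] by simp
    qed
    have "dist (l2_inner (P i) h \<gamma>) (l2_inner (P j) h \<gamma>) < e" if "i \<ge> max N1 N2" "j \<ge> max N1 N2" for i j
    proof -
      have "dist (l2_inner (P i) h \<gamma>) (l2_inner (P j) h \<gamma>)
          \<le> dist (l2_inner (P i) h \<gamma>) (l2_inner (P i) p \<gamma>)
            + dist (l2_inner (P i) p \<gamma>) (l2_inner (P j) p \<gamma>)
            + dist (l2_inner (P j) h \<gamma>) (l2_inner (P j) p \<gamma>)"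
        using dist_triangle[of "l2_inner (P i) h \<gamma>" "l2_inner (P j) h \<gamma>" "l2_inner (P i) p \<gamma>"]
          dist_triangle[of "l2_inner (P i) p \<gamma>" "l2_inner (P j) h \<gamma>" "l2_inner (P j) p \<gamma>"]
        by (simp add: dist_commute[of "l2_inner (P j) h \<gamma>"])
      then show ?thesis
        using N1[of i j] close[of i] close[of j] that by simp
    qed
    then show "\<exists>N. \<forall>i\<ge>N. \<forall>j\<ge>N. dist (l2_inner (P i) h \<gamma>) (l2_inner (P j) h \<gamma>) < e"
      by blast
  qed
  then show ?thesis
    by (rule Cauchy_convergent)
qed

text \<open>This is the nontrivial half of Parseval's identity: no mass of an almost periodic function
  escapes its Fourier coefficients.\<close>

lemma besicovitch_ap_function_parseval:
  assumes h: "besicovitch_ap_function \<mu> A h"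
    and a: "\<And>\<gamma>. \<gamma> \<in> dual_group \<Longrightarrow> (\<lambda>n. l2_inner (P n) h \<gamma>) \<longlonglongrightarrow> a \<gamma>"
    and N: "(\<lambda>n. (l2_norm (P n) h)\<^sup>2) \<longlonglongrightarrow> N" and "0 < \<epsilon>"
  obtains F where "finite F" "F \<subseteq> dual_group" "N \<le> (\<Sum>\<gamma>\<in>F. (cmod (a \<gamma>))\<^sup>2) + \<epsilon>"
proof -
  obtain C where C: "\<And>t. cmod (h t) \<le> C" and hm: "h \<in> borel_measurable \<mu>"
    using h unfolding besicovitch_ap_function_def bounded_iff by auto
  obtain F c where F: "finite F" "F \<subseteq> dual_group"
    and ev: "\<forall>\<^sub>F n in sequentially. l2_norm (P n) (\<lambda>t. h t - (\<Sum>\<gamma>\<in>F. c \<gamma> * \<gamma> t)) < sqrt \<epsilon>"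
    using besicovitch_ap_function_approximation[OF h, of "sqrt \<epsilon>"] \<open>0 < \<epsilon>\<close> by auto
  have "(\<lambda>n. (l2_norm (P n) (\<lambda>t. h t - (\<Sum>\<gamma>\<in>F. c \<gamma> * \<gamma> t)))\<^sup>2) \<longlonglongrightarrow>
           N - (\<Sum>\<gamma>\<in>F. (cmod (a \<gamma>))\<^sup>2) + (\<Sum>\<gamma>\<in>F. (cmod (c \<gamma> - a \<gamma>))\<^sup>2)"
    using F(2) by (intro trigonometric_distance_limit[OF hm C F _ N] a) auto
  moreover have "\<forall>\<^sub>F n in sequentially. (l2_norm (P n) (\<lambda>t. h t - (\<Sum>\<gamma>\<in>F. c \<gamma> * \<gamma> t)))\<^sup>2 \<le> \<epsilon>"
    using ev
  proof eventually_elim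
    case (elim n)
    then have "(l2_norm (P n) (\<lambda>t. h t - (\<Sum>\<gamma>\<in>F. c \<gamma> * \<gamma> t)))\<^sup>2 \<le> (sqrt \<epsilon>)\<^sup>2"
      by (intro power_mono) auto
    then show ?case
      using \<open>0 < \<epsilon>\<close> by simp
  qed
  ultimately have "N - (\<Sum>\<gamma>\<in>F. (cmod (a \<gamma>))\<^sup>2) + (\<Sum>\<gamma>\<in>F. (cmod (c \<gamma> - a \<gamma>))\<^sup>2) \<le> \<epsilon>"
    by (rule tendsto_upperbound) simp
  then have "N \<le> (\<Sum>\<gamma>\<in>F. (cmod (a \<gamma>))\<^sup>2) + \<epsilon>"
    using sum_nonneg[of F "\<lambda>\<gamma>. (cmod (c \<gamma> - a \<gamma>))\<^sup>2"] by simp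
  then show ?thesis
    using that F by blast
qed

end

section \<open>Eigenfunctions of an ergodic system\<close>

locale ergodic_system = compact_regular_prob_space M
  for M :: "'x::t2_space measure"
    and act :: "'g::{topological_ab_group_add, t2_space} \<Rightarrow> 'x \<Rightarrow> 'x" +
  assumes system: "topological_dynamical_system act"
    and invariant: "distr M M (act t) = M"
    and ergodic: "ergodic_measure act M"
begin

lemma act_zero [simp]: "act 0 y = y"
  and act_add: "act (s + t) y = act s (act t y)"
  and act_continuous2: "continuous_on UNIV (\<lambda>(t, y). act t y)"
  using system by (auto simp: topological_dynamical_system_def)

lemma act_continuous: "continuous_on UNIV (act t)"
  using continuous_on_compose2[OF act_continuous2, of UNIV "\<lambda>y. (t, y)"]
  by (simp add: continuous_on_Pair continuous_on_const continuous_on_id)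

lemma orbit_continuous: "continuous_on UNIV (\<lambda>t. act t y)"
  using continuous_on_compose2[OF act_continuous2, of UNIV "\<lambda>t. (t, y)"]
  by (simp add: continuous_on_Pair continuous_on_const continuous_on_id)

lemma continuous_act:
  assumes "continuous_on UNIV f"
  shows "continuous_on UNIV (\<lambda>y. f (act t y))"
  using continuous_on_compose2[OF assms act_continuous] by simp

lemma continuous_along_orbit:
  assumes "continuous_on UNIV f"
  shows "continuous_on UNIV (\<lambda>t. f (act t y))"
  using continuous_on_compose2[OF assms orbit_continuous] by simp

lemma measurable_act [measurable]: "act t \<in> M \<rightarrow>\<^sub>M M"
  using continuous_measurable[OF act_continuous] measurable_cong_sets[OF refl sets_eq_borel] by blast

lemma measurable_compose_act: "f \<in> borel_measurable M \<Longrightarrow> (\<lambda>y. f (act t y)) \<in> borel_measurable M"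
  by (rule measurable_compose[OF measurable_act])

lemma integral_act:
  fixes f :: "'x \<Rightarrow> 'b::{banach, second_countable_topology}"
  assumes "f \<in> borel_measurable M"
  shows "(LINT y|M. f (act t y)) = (LINT y|M. f y)"
  using integral_distr[OF measurable_act assms, of t] by (simp add: invariant)

lemma AE_act: "AE y in M. Q y \<Longrightarrow> AE y in M. Q (act t y)"
  using AE_distrD[OF measurable_act[of t], where P = Q] unfolding invariant .

lemma sq_integrable_act:
  assumes "f \<in> sq_integrable M"
  shows "(\<lambda>y. f (act t y)) \<in> sq_integrable M"
proof -
  have "integrable M (\<lambda>y. (cmod (f (act t y)))\<^sup>2)"
    using integrable_distr[OF measurable_act, of t "\<lambda>y. (cmod (f y))\<^sup>2"] assms
    by (simp add: invariant sq_integrable_def)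
  then show ?thesis
    using assms measurable_compose_act by (auto simp: sq_integrable_def)
qed

lemma l2_norm_act:
  assumes "f \<in> borel_measurable M"
  shows "l2_norm M (\<lambda>y. f (act t y)) = l2_norm M f"
proof -
  have "(LINT y|M. (cmod (f (act t y)))\<^sup>2) = (LINT y|M. (cmod (f y))\<^sup>2)"
    by (rule integral_act) (use assms in measurable)
  then show ?thesis
    by (simp add: l2_norm_def)
qed

lemma l2_inner_act:
  assumes "f \<in> borel_measurable M" and "g \<in> borel_measurable M"
  shows "l2_inner M (\<lambda>y. f (act t y)) (\<lambda>y. g (act t y)) = l2_inner M f g"
  unfolding l2_inner_def by (rule integral_act) (use assms in measurable)

lemma invariant_imp_constant:
  fixes f :: "'x \<Rightarrow> complex"
  assumes "f \<in> borel_measurable M" and "\<And>t. AE y in M. f (act t y) = f y"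
  shows "\<exists>c. AE y in M. f y = c"
  by (rule ergodic[unfolded ergodic_measure_def, rule_format, OF assms])

lemma eigenspace_sq_integrable: "f \<in> eigenspace act M \<gamma> \<Longrightarrow> f \<in> sq_integrable M"
  by (simp add: eigenspace_def)

lemma eigenspace_act: "f \<in> eigenspace act M \<gamma> \<Longrightarrow> AE y in M. f (act t y) = \<gamma> t * f y"
  by (simp add: eigenspace_def)

lemma eigenspace_scale: "f \<in> eigenspace act M \<gamma> \<Longrightarrow> (\<lambda>y. c * f y) \<in> eigenspace act M \<gamma>"
  unfolding eigenspace_def by auto

lemma eigenspace_cong_AE:
  assumes f: "f \<in> eigenspace act M \<gamma>" and g: "g \<in> borel_measurable M" and eq: "AE y in M. f y = g y"
  shows "g \<in> eigenspace act M \<gamma>"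
proof -
  have "AE y in M. g (act t y) = \<gamma> t * g y" for t
    using eigenspace_act[OF f, of t] eq AE_act[OF eq, of t] by eventually_elim simp
  then show ?thesis
    using sq_integrable_cong_AE[OF eigenspace_sq_integrable[OF f] g eq] by (simp add: eigenspace_def)
qed

lemma eigenspaces_orthogonal:
  assumes f: "f \<in> eigenspace act M \<gamma>" and g: "g \<in> eigenspace act M \<gamma>'"
    and "\<gamma> \<in> dual_group" "\<gamma>' \<in> dual_group" "\<gamma> \<noteq> \<gamma>'"
  shows "l2_inner M f g = 0"
proof -
  obtain t where t: "\<gamma> t \<noteq> \<gamma>' t"
    using \<open>\<gamma> \<noteq> \<gamma>'\<close> by blast
  have meas: "f \<in> borel_measurable M" "g \<in> borel_measurable M"
    using f g by (auto dest!: eigenspace_sq_integrable sq_integrable_measurable)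
  have "l2_inner M f g = l2_inner M (\<lambda>y. f (act t y)) (\<lambda>y. g (act t y))"
    using meas by (rule l2_inner_act[symmetric])
  also have "\<dots> = l2_inner M (\<lambda>y. \<gamma> t * f y) (\<lambda>y. \<gamma>' t * g y)"
    by (intro l2_inner_cong_AE eigenspace_act[OF f] eigenspace_act[OF g])
       (use meas in \<open>auto intro: measurable_compose_act\<close>)
  also have "\<dots> = \<gamma> t * cnj (\<gamma>' t) * l2_inner M f g"
    by (simp add: l2_inner_scale_left l2_inner_scale_right)
  finally have "(1 - \<gamma> t * cnj (\<gamma>' t)) * l2_inner M f g = 0"
    by (simp add: left_diff_distrib)
  moreover have "\<gamma> t = \<gamma>' t" if "\<gamma> t * cnj (\<gamma>' t) = 1"
  proof -
    have "\<gamma> t = \<gamma> t * (\<gamma>' t * cnj (\<gamma>' t))"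
      unfolding dual_group_mult_cnj[OF \<open>\<gamma>' \<in> dual_group\<close>] by simp
    also have "\<dots> = (\<gamma> t * cnj (\<gamma>' t)) * \<gamma>' t"
      by (simp only: mult_ac)
    finally show ?thesis
      unfolding that by simp
  qed
  ultimately show ?thesis
    using t by auto
qed

text \<open>Eigenfunctions of an ergodic system have constant modulus, and the quotient of two
  eigenfunctions for the same character is invariant; so eigenspaces are one-dimensional.\<close>

lemma eigenspace_one_dimensional:
  assumes \<gamma>: "\<gamma> \<in> dual_group" and u: "u \<in> eigenspace act M \<gamma>" and "l2_norm M u = 1"
    and f: "f \<in> eigenspace act M \<gamma>"
  shows "AE y in M. f y = l2_inner M f u * u y"
proof -
  have [measurable]: "u \<in> borel_measurable M" "f \<in> borel_measurable M"
    by (rule sq_integrable_measurable[OF eigenspace_sq_integrable], rule f u)+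
  have norm1: "cmod (\<gamma> t) = 1" for t
    by (rule dual_group_norm[OF \<gamma>])
  have "AE y in M. complex_of_real (cmod (u (act t y))) = complex_of_real (cmod (u y))" for t
    using eigenspace_act[OF u, of t]
  proof eventually_elim
    case (elim y)
    show ?case
      unfolding elim norm_mult norm1 mult_1_left ..
  qed
  moreover have "(\<lambda>y. complex_of_real (cmod (u y))) \<in> borel_measurable M"
    by measurable
  ultimately obtain r where r: "AE y in M. complex_of_real (cmod (u y)) = r"
    using invariant_imp_constant[of "\<lambda>y. complex_of_real (cmod (u y))"] by blast
  have "r \<noteq> 0"
  proof
    assume "r = 0"
    with r have "AE y in M. u y = 0"
      by (auto elim: eventually_mono)
    then have "l2_norm M u = l2_norm M (\<lambda>y. 0)"
      by (intro l2_norm_cong_AE) auto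
    then show False
      using \<open>l2_norm M u = 1\<close> by (simp add: l2_norm_def)
  qed
  with r have nz: "AE y in M. u y \<noteq> 0"
    by (auto elim!: eventually_mono)
  have "AE y in M. f (act t y) / u (act t y) = f y / u y" for t
    using eigenspace_act[OF u, of t] eigenspace_act[OF f, of t]
  proof eventually_elim
    case (elim y)
    have "\<gamma> t \<noteq> 0"
      using norm1[of t] by auto
    then show ?case
      unfolding elim by (rule mult_divide_mult_cancel_left)
  qed
  moreover have "(\<lambda>y. f y / u y) \<in> borel_measurable M"
    by measurable
  ultimately obtain c where "AE y in M. f y / u y = c"
    using invariant_imp_constant[of "\<lambda>y. f y / u y"] by blast
  with nz have fc: "AE y in M. f y = c * u y"
    by eventually_elim auto
  then have "l2_inner M f u = l2_inner M (\<lambda>y. c * u y) u"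
    by (intro l2_inner_cong_AE) auto
  also have "\<dots> = c"
    using \<open>l2_norm M u = 1\<close> by (simp add: l2_inner_scale_left l2_inner_self)
  finally show ?thesis
    using fc by simp
qed

lemma unit_eigenfunction:
  assumes "u \<in> eigenspace act M \<gamma>" "\<gamma> \<in> dual_group" "l2_norm M u = 1"
  shows "eigenfunction act M \<gamma> u"
proof -
  have False if "AE y in M. u y = 0"
  proof -
    have "l2_norm M u = l2_norm M (\<lambda>y. 0)"
      using that eigenspace_sq_integrable[OF assms(1)] by (intro l2_norm_cong_AE) auto
    then show False
      using assms(3) by (simp add: l2_norm_def)
  qed
  then show ?thesis
    using assms by (auto simp: eigenfunction_def)
qed

lemma eigenfunction_norm_pos:
  assumes "eigenfunction act M \<gamma> f"
  shows "0 < l2_norm M f"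
  using assms l2_norm_eq_0_imp_AE[of f M] l2_norm_nonneg[of M f]
  by (auto simp: eigenfunction_def eigenspace_def order_less_le)

lemma eigenfunction_unique_character:
  assumes "eigenfunction act M \<gamma> f" "eigenfunction act M \<gamma>' f"
  shows "\<gamma> = \<gamma>'"
proof (rule ccontr)
  assume "\<gamma> \<noteq> \<gamma>'"
  then have "l2_inner M f f = 0"
    using assms by (intro eigenspaces_orthogonal) (auto simp: eigenfunction_def)
  then show False
    using eigenfunction_norm_pos[OF assms(1)] by (simp add: l2_inner_self)
qed

lemma ex_unit_eigenfunction:
  assumes "\<gamma> \<in> eigenvalues act M"
  shows "\<exists>u\<in>eigenspace act M \<gamma>. l2_norm M u = 1"
proof -
  obtain f where f: "eigenfunction act M \<gamma> f"
    using assms by (auto simp: eigenvalues_def)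
  define c where "c = complex_of_real (1 / l2_norm M f)"
  have "l2_norm M (\<lambda>y. c * f y) = 1"
    unfolding l2_norm_scale c_def using eigenfunction_norm_pos[OF f] by (simp add: norm_divide)
  moreover have "(\<lambda>y. c * f y) \<in> eigenspace act M \<gamma>"
    using f by (intro eigenspace_scale) (simp add: eigenfunction_def)
  ultimately show ?thesis
    by blast
qed

lemma eigenvalues_dual_group: "\<gamma> \<in> eigenvalues act M \<Longrightarrow> \<gamma> \<in> dual_group"
  by (auto simp: eigenvalues_def eigenfunction_def)

definition unit_eigenfunctions :: "(('g \<Rightarrow> complex) \<Rightarrow> 'x \<Rightarrow> complex) \<Rightarrow> bool" where
  "unit_eigenfunctions u \<longleftrightarrow>
     (\<forall>\<gamma>\<in>eigenvalues act M. u \<gamma> \<in> eigenspace act M \<gamma> \<and> l2_norm M (u \<gamma>) = 1)"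

lemma ex_unit_eigenfunctions: "\<exists>u. unit_eigenfunctions u"
  unfolding unit_eigenfunctions_def using ex_unit_eigenfunction by metis

lemma unit_eigenfunctions_sq_integrable:
  "unit_eigenfunctions u \<Longrightarrow> \<gamma> \<in> eigenvalues act M \<Longrightarrow> u \<gamma> \<in> sq_integrable M"
  by (auto simp: unit_eigenfunctions_def intro: eigenspace_sq_integrable)

lemma unit_eigenfunctions_orthonormal:
  assumes u: "unit_eigenfunctions u" and "\<gamma> \<in> eigenvalues act M" "\<gamma>' \<in> eigenvalues act M"
  shows "l2_inner M (u \<gamma>) (u \<gamma>') = (if \<gamma> = \<gamma>' then 1 else 0)"
proof (cases "\<gamma> = \<gamma>'")
  case True
  then show ?thesis
    using assms by (simp add: unit_eigenfunctions_def l2_inner_self)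
next
  case False
  then have "l2_inner M (u \<gamma>) (u \<gamma>') = 0"
    using assms eigenvalues_dual_group
    by (intro eigenspaces_orthogonal[of _ \<gamma> _ \<gamma>']) (auto simp: unit_eigenfunctions_def)
  then show ?thesis
    using False by simp
qed

lemma unit_eigenfunctions_expansion:
  assumes u: "unit_eigenfunctions u" and f: "f \<in> sq_integrable M"
    and F: "finite F" "F \<subseteq> eigenvalues act M"
  shows "(l2_norm M (\<lambda>y. f y - (\<Sum>\<gamma>\<in>F. c \<gamma> * u \<gamma> y)))\<^sup>2
       = (l2_norm M f)\<^sup>2 - (\<Sum>\<gamma>\<in>F. (cmod (l2_inner M f (u \<gamma>)))\<^sup>2)
           + (\<Sum>\<gamma>\<in>F. (cmod (c \<gamma> - l2_inner M f (u \<gamma>)))\<^sup>2)"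
  using F by (intro l2_norm_diff_orthonormal_combination f unit_eigenfunctions_sq_integrable[OF u]
      unit_eigenfunctions_orthonormal[OF u]) auto

lemma bessel:
  assumes "unit_eigenfunctions u" "f \<in> sq_integrable M" "finite F" "F \<subseteq> eigenvalues act M"
  shows "(\<Sum>\<gamma>\<in>F. (cmod (l2_inner M f (u \<gamma>)))\<^sup>2) \<le> (l2_norm M f)\<^sup>2"
  using unit_eigenfunctions_expansion[OF assms, of "\<lambda>\<gamma>. l2_inner M f (u \<gamma>)"]
    zero_le_power2[of "l2_norm M (\<lambda>y. f y - (\<Sum>\<gamma>\<in>F. l2_inner M f (u \<gamma>) * u \<gamma> y))"]
  by simp

text \<open>In pure point spectrum, functions are approximated by finite combinations of arbitrary
  eigenfunctions; by one-dimensionality these may be regrouped as combinations of a fixed choice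
  of unit eigenfunctions, one for each eigenvalue.\<close>

lemma pure_point_approximation:
  assumes pp: "pure_point_spectrum act M" and u: "unit_eigenfunctions u"
    and f: "f \<in> sq_integrable M" and "0 < \<epsilon>"
  obtains F c where "finite F" "F \<subseteq> eigenvalues act M"
    "l2_norm M (\<lambda>y. f y - (\<Sum>\<gamma>\<in>F. c \<gamma> * u \<gamma> y)) < \<epsilon>"
proof -
  have "f \<in> l2_closed_span M {e. \<exists>\<gamma>. eigenfunction act M \<gamma> e}"
    using pp f by (simp add: pure_point_spectrum_def)
  then obtain g where g: "g \<in> lin_combs {e. \<exists>\<gamma>. eigenfunction act M \<gamma> e}"
    "l2_norm M (\<lambda>y. f y - g y) < \<epsilon>"
    unfolding l2_closed_span_def using \<open>0 < \<epsilon>\<close> by blast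
  from g(1) obtain E a where E: "finite E" "E \<subseteq> {e. \<exists>\<gamma>. eigenfunction act M \<gamma> e}"
    and g_eq: "g = (\<lambda>y. \<Sum>e\<in>E. a e * e y)"
    unfolding lin_combs_def by blast
  have "\<forall>e\<in>E. \<exists>\<gamma>. eigenfunction act M \<gamma> e"
    using E(2) by blast
  then obtain \<kappa> where \<kappa>: "eigenfunction act M (\<kappa> e) e" if "e \<in> E" for e
    using bchoice[of E "\<lambda>e \<gamma>. eigenfunction act M \<gamma> e"] by blast
  have ev: "\<kappa> e \<in> eigenvalues act M" if "e \<in> E" for e
    using \<kappa>[OF that] by (auto simp: eigenvalues_def)
  have esq: "e \<in> sq_integrable M" if "e \<in> E" for e
    using \<kappa>[OF that] by (simp add: eigenfunction_def eigenspace_def)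
  define d where "d e = l2_inner M e (u (\<kappa> e))" for e
  have "AE y in M. e y = d e * u (\<kappa> e) y" if "e \<in> E" for e
    unfolding d_def using \<kappa>[OF that] u ev[OF that]
    by (intro eigenspace_one_dimensional) (auto simp: unit_eigenfunctions_def eigenfunction_def)
  then have AE_E: "AE y in M. \<forall>e\<in>E. e y = d e * u (\<kappa> e) y"
    using E(1) by (simp add: AE_finite_all)
  define c where "c \<gamma> = (\<Sum>e\<in>{e \<in> E. \<kappa> e = \<gamma>}. a e * d e)" for \<gamma>
  have regroup: "(\<Sum>e\<in>E. a e * (d e * u (\<kappa> e) y)) = (\<Sum>\<gamma>\<in>\<kappa> ` E. c \<gamma> * u \<gamma> y)" for y
  proof -
    have "(\<Sum>e\<in>E. a e * (d e * u (\<kappa> e) y))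
        = (\<Sum>\<gamma>\<in>\<kappa> ` E. \<Sum>e\<in>{e \<in> E. \<kappa> e = \<gamma>}. a e * (d e * u (\<kappa> e) y))"
      using E(1) by (rule sum.image_gen)
    also have "\<dots> = (\<Sum>\<gamma>\<in>\<kappa> ` E. c \<gamma> * u \<gamma> y)"
      unfolding c_def sum_distrib_right by (intro sum.cong refl) (auto simp: mult.assoc)
    finally show ?thesis .
  qed
  have "AE y in M. f y - g y = f y - (\<Sum>\<gamma>\<in>\<kappa> ` E. c \<gamma> * u \<gamma> y)"
    using AE_E
  proof eventually_elim
    case (elim y)
    then show ?case
      unfolding g_eq regroup[symmetric] by (intro arg_cong2[where f = minus] refl sum.cong) simp_all
  qed
  moreover have "g \<in> sq_integrable M"
    unfolding g_eq using esq by (intro sq_integrable_combination[where e = "\<lambda>e. e"]) auto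
  moreover have "(\<lambda>y. \<Sum>\<gamma>\<in>\<kappa> ` E. c \<gamma> * u \<gamma> y) \<in> sq_integrable M"
    using ev unit_eigenfunctions_sq_integrable[OF u] by (intro sq_integrable_combination) auto
  ultimately have "l2_norm M (\<lambda>y. f y - g y) = l2_norm M (\<lambda>y. f y - (\<Sum>\<gamma>\<in>\<kappa> ` E. c \<gamma> * u \<gamma> y))"
    using f by (intro l2_norm_cong_AE sq_integrable_measurable sq_integrable_diff)
  then show ?thesis
    using that[of "\<kappa> ` E" c] E(1) ev g(2) by auto
qed

text \<open>The best approximation of \<open>f\<close> by a multiple of \<open>e\<close> is \<open>\<langle>f, e\<rangle> e\<close>, so the closed span of \<open>e\<close>
  is the line through \<open>e\<close>, up to null sets; this line is the eigenspace.\<close>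

lemma unit_eigenfunction_orthonormal_basis:
  assumes \<gamma>: "\<gamma> \<in> dual_group" and e: "e \<in> eigenspace act M \<gamma>" "l2_norm M e = 1"
  shows "orthonormal_basis_of M {e} (eigenspace act M \<gamma>)"
proof -
  note esq = eigenspace_sq_integrable[OF e(1)]
  have best: "(l2_norm M (\<lambda>y. f y - l2_inner M f e * e y))\<^sup>2 \<le> (l2_norm M (\<lambda>y. f y - b * e y))\<^sup>2"
    if f: "f \<in> sq_integrable M" for f b
  proof -
    have "(l2_norm M (\<lambda>y. f y - c * e y))\<^sup>2
        = (l2_norm M f)\<^sup>2 - (cmod (l2_inner M f e))\<^sup>2 + (cmod (c - l2_inner M f e))\<^sup>2" for c
      using l2_norm_diff_orthonormal_combination[OF f, of "{e}" "\<lambda>e. e" "\<lambda>_. c"] esq e(2)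
      by (simp add: l2_inner_self)
    then show ?thesis
      by simp
  qed
  have "f \<in> l2_closed_span M {e} \<longleftrightarrow> f \<in> eigenspace act M \<gamma>" for f
  proof
    assume "f \<in> l2_closed_span M {e}"
    then have f: "f \<in> sq_integrable M"
      and approx: "\<And>\<epsilon>. 0 < \<epsilon> \<Longrightarrow> \<exists>g\<in>lin_combs {e}. l2_norm M (\<lambda>y. f y - g y) < \<epsilon>"
      by (auto simp: l2_closed_span_def)
    let ?r = "l2_norm M (\<lambda>y. f y - l2_inner M f e * e y)"
    have "?r = 0"
    proof (rule ccontr)
      assume "?r \<noteq> 0"
      then have "0 < ?r"
        using l2_norm_nonneg order_le_imp_less_or_eq by metis
      from approx[OF this] obtain g where g: "g \<in> lin_combs {e}" "l2_norm M (\<lambda>y. f y - g y) < ?r"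
        by blast
      obtain F c where F: "F \<subseteq> {e}" and g_eq: "g = (\<lambda>y. \<Sum>i\<in>F. c i * i y)"
        using g(1) unfolding lin_combs_def by blast
      have "\<exists>b. g = (\<lambda>y. b * e y)"
      proof (cases "F = {}")
        case True
        then show ?thesis
          by (intro exI[of _ 0]) (simp add: g_eq)
      next
        case False
        then have "F = {e}"
          using F by blast
        then show ?thesis
          by (intro exI[of _ "c e"]) (simp add: g_eq)
      qed
      then obtain b where "g = (\<lambda>y. b * e y)" ..
      then have "?r\<^sup>2 \<le> (l2_norm M (\<lambda>y. f y - g y))\<^sup>2"
        using best[OF f, of b] by simp
      then have "?r \<le> l2_norm M (\<lambda>y. f y - g y)"
        by (rule power2_le_imp_le) simp
      then show False
        using g(2) by simp
    qed
    moreover have "(\<lambda>y. f y - l2_inner M f e * e y) \<in> sq_integrable M"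
      by (intro sq_integrable_diff sq_integrable_scale f esq)
    ultimately have "AE y in M. f y - l2_inner M f e * e y = 0"
      by (intro l2_norm_eq_0_imp_AE)
    then have "AE y in M. l2_inner M f e * e y = f y"
      by eventually_elim simp
    then show "f \<in> eigenspace act M \<gamma>"
      by (rule eigenspace_cong_AE[OF eigenspace_scale[OF e(1)] sq_integrable_measurable[OF f]])
  next
    assume f: "f \<in> eigenspace act M \<gamma>"
    note fsq = eigenspace_sq_integrable[OF f]
    have "AE y in M. f y = l2_inner M f e * e y"
      by (rule eigenspace_one_dimensional[OF \<gamma> e f])
    then have "AE y in M. f y - l2_inner M f e * e y = 0"
      by eventually_elim simp
    then have "l2_norm M (\<lambda>y. f y - l2_inner M f e * e y) = l2_norm M (\<lambda>y. 0)"
      by (intro l2_norm_cong_AE sq_integrable_measurable sq_integrable_diff sq_integrable_scale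
          sq_integrable_zero fsq esq)
    also have "\<dots> = 0"
      by (simp add: l2_norm_def)
    finally have zero: "l2_norm M (\<lambda>y. f y - l2_inner M f e * e y) = 0" .
    have mem: "(\<lambda>y. l2_inner M f e * e y) \<in> lin_combs {e}"
      unfolding lin_combs_def by (rule CollectI, intro exI[of _ "{e}"] exI[of _ "\<lambda>_. l2_inner M f e"]) simp
    then show "f \<in> l2_closed_span M {e}"
      unfolding l2_closed_span_def using fsq
    proof (intro CollectI conjI allI impI)
      fix \<epsilon> :: real assume "0 < \<epsilon>"
      then show "\<exists>g\<in>lin_combs {e}. l2_norm M (\<lambda>y. f y - g y) < \<epsilon>"
        using zero by (intro bexI[OF _ mem]) simp
    qed
  qed
  then have "l2_closed_span M {e} = eigenspace act M \<gamma>"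
    by blast
  then show ?thesis
    unfolding orthonormal_basis_of_def using esq e(2) by (simp add: l2_inner_self)
qed

text \<open>The closed span of the empty set consists of null functions only.\<close>

lemma orthonormal_basis_of_eigenspace_nonempty:
  assumes "\<gamma> \<in> eigenvalues act M" and basis: "orthonormal_basis_of M S (eigenspace act M \<gamma>)"
  shows "S \<noteq> {}"
proof
  assume "S = {}"
  obtain f where f: "eigenfunction act M \<gamma> f"
    using assms(1) by (auto simp: eigenvalues_def)
  then have "f \<in> l2_closed_span M {}"
    using basis \<open>S = {}\<close> by (simp add: orthonormal_basis_of_def eigenfunction_def)
  then obtain g where "g \<in> lin_combs {}" "l2_norm M (\<lambda>y. f y - g y) < l2_norm M f"
    using eigenfunction_norm_pos[OF f] unfolding l2_closed_span_def by blast
  moreover from this have "g = (\<lambda>y. 0)"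
    by (auto simp: lin_combs_def)
  ultimately show False
    by simp
qed

lemma constant_eigenfunction: "(\<lambda>y. 1) \<in> eigenspace act M (\<lambda>t. 1)" "l2_norm M (\<lambda>y. 1) = 1"
  by (simp_all add: eigenspace_def sq_integrable_const l2_norm_const)

lemma trivial_character: "(\<lambda>t. 1) \<in> dual_group"
  by (simp add: dual_group_def continuous_on_const)

lemma trivial_character_eigenvalue: "(\<lambda>t. 1) \<in> eigenvalues act M"
  unfolding eigenvalues_def
  by (rule CollectI, rule exI,
      rule unit_eigenfunction[OF constant_eigenfunction(1) trivial_character constant_eigenfunction(2)])

end

section \<open>Equivariant functionals on the continuous functions\<close>

text \<open>A functional on the continuous functions that transforms under the action like a character
  \<open>\<gamma>\<close> and is bounded by the \<open>L\<^sup>2\<close> norm sees nothing but the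
  \<open>\<gamma>\<close>-component of its argument. The reason is that it extends continuously to
  \<open>L\<^sup>2\<close>, and that its value at an eigenfunction for \<open>\<beta>\<close> is multiplied both by
  \<open>\<beta> s\<close> and by \<open>\<gamma> s\<close> under the action of \<open>s\<close>, hence vanishes if
  \<open>\<beta> \<noteq> \<gamma>\<close>.\<close>

locale equivariant_functional = ergodic_system M act
  for M :: "'x::t2_space measure"
    and act :: "'g::{topological_ab_group_add, t2_space} \<Rightarrow> 'x \<Rightarrow> 'x" +
  fixes a :: "('x \<Rightarrow> complex) \<Rightarrow> complex" and \<gamma> :: "'g \<Rightarrow> complex"
  assumes linear: "continuous_on UNIV f \<Longrightarrow> continuous_on UNIV g \<Longrightarrow>
                     a (\<lambda>y. f y + c * g y) = a f + c * a g"
    and bounded: "continuous_on UNIV f \<Longrightarrow> cmod (a f) \<le> l2_norm M f"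
    and equivariant: "continuous_on UNIV f \<Longrightarrow> a (\<lambda>y. f (act s y)) = \<gamma> s * a f"
    and character: "\<gamma> \<in> dual_group"
begin

text \<open>Eigenfunctions are only defined up to null sets and need not be continuous. The continuous
  extension is therefore handled as a relation: \<open>extension_value g z\<close> says that its value at
  \<open>g\<close> is \<open>z\<close>.\<close>

definition extension_value :: "('x \<Rightarrow> complex) \<Rightarrow> complex \<Rightarrow> bool" where
  "extension_value g z \<longleftrightarrow>
     (\<forall>f. continuous_on UNIV f \<longrightarrow> cmod (a f - z) \<le> l2_norm M (\<lambda>y. f y - g y))"

lemma extension_valueD:
  "extension_value g z \<Longrightarrow> continuous_on UNIV f \<Longrightarrow> cmod (a f - z) \<le> l2_norm M (\<lambda>y. f y - g y)"
  by (simp add: extension_value_def)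

lemma functional_lipschitz:
  assumes f: "continuous_on UNIV f" and g: "continuous_on UNIV g"
  shows "cmod (a f - a g) \<le> l2_norm M (\<lambda>y. f y - g y)"
proof -
  have "a (\<lambda>y. f y - g y) = a f - a g"
    using linear[OF f g, of "-1"] by simp
  then show ?thesis
    using bounded[OF continuous_on_diff[OF f g]] by simp
qed

lemma extension_value_exists:
  assumes g: "g \<in> sq_integrable M"
  shows "\<exists>z. extension_value g z"
proof -
  have "\<exists>f. continuous_on UNIV f \<and> l2_norm M (\<lambda>y. g y - f y) < 1 / real (Suc n)" for n
    by (rule continuous_dense[OF g, of "1 / real (Suc n)"]) auto
  then obtain f where f: "\<And>n. continuous_on UNIV (f n)"
    "\<And>n. l2_norm M (\<lambda>y. g y - f n y) < 1 / real (Suc n)"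
    by metis
  have lim: "(\<lambda>n. l2_norm M (\<lambda>y. g y - f n y)) \<longlonglongrightarrow> 0"
    using f(2) by (intro Lim_null_comparison[OF _ LIMSEQ_inverse_real_of_nat] always_eventually allI)
      (simp add: less_imp_le inverse_eq_divide)
  have "Cauchy (\<lambda>n. a (f n))"
  proof (rule metric_CauchyI)
    fix e :: real assume "0 < e"
    then have "\<forall>\<^sub>F n in sequentially. l2_norm M (\<lambda>y. g y - f n y) < e / 2"
      using lim by (intro order_tendstoD(2)[of _ 0]) auto
    then obtain N where N: "\<And>n. n \<ge> N \<Longrightarrow> l2_norm M (\<lambda>y. g y - f n y) < e / 2"
      by (auto simp: eventually_sequentially)
    have "dist (a (f i)) (a (f j)) < e" if "i \<ge> N" "j \<ge> N" for i j
    proof -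
      have "cmod (a (f i) - a (f j)) \<le> l2_norm M (\<lambda>y. f i y - f j y)"
        by (intro functional_lipschitz f)
      also have "\<dots> \<le> l2_norm M (\<lambda>y. f i y - g y) + l2_norm M (\<lambda>y. g y - f j y)"
        by (intro l2_norm_diff_triangle continuous_sq_integrable f g)
      also have "\<dots> < e / 2 + e / 2"
        using N that by (intro add_strict_mono) (simp_all add: l2_norm_minus_commute[of M _ g])
      finally show ?thesis
        by (simp add: dist_norm)
    qed
    then show "\<exists>N. \<forall>i\<ge>N. \<forall>j\<ge>N. dist (a (f i)) (a (f j)) < e"
      by blast
  qed
  then obtain z where z: "(\<lambda>n. a (f n)) \<longlonglongrightarrow> z"
    using Cauchy_convergent convergent_def by blast
  have "cmod (a h - z) \<le> l2_norm M (\<lambda>y. h y - g y)" if h: "continuous_on UNIV h" for h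
  proof (rule LIMSEQ_le)
    show "(\<lambda>n. cmod (a h - a (f n))) \<longlonglongrightarrow> cmod (a h - z)"
      using z by (intro tendsto_intros)
    have "(\<lambda>n. l2_norm M (\<lambda>y. h y - g y) + l2_norm M (\<lambda>y. g y - f n y)) \<longlonglongrightarrow>
        l2_norm M (\<lambda>y. h y - g y) + 0"
      using lim by (intro tendsto_add tendsto_const)
    then show "(\<lambda>n. l2_norm M (\<lambda>y. h y - g y) + l2_norm M (\<lambda>y. g y - f n y)) \<longlonglongrightarrow>
        l2_norm M (\<lambda>y. h y - g y)"
      by simp
    have "cmod (a h - a (f n)) \<le> l2_norm M (\<lambda>y. h y - g y) + l2_norm M (\<lambda>y. g y - f n y)" for n
      using functional_lipschitz[OF h f(1)]
        l2_norm_diff_triangle[OF continuous_sq_integrable[OF h] g continuous_sq_integrable[OF f(1)]]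
      by (rule order_trans)
    then show "\<exists>N. \<forall>n\<ge>N. cmod (a h - a (f n))
        \<le> l2_norm M (\<lambda>y. h y - g y) + l2_norm M (\<lambda>y. g y - f n y)"
      by blast
  qed
  then show ?thesis
    unfolding extension_value_def by blast
qed

lemma extension_value_unique:
  assumes z: "extension_value g z" and w: "extension_value g w" and g: "g \<in> sq_integrable M"
  shows "z = w"
proof -
  have "cmod (z - w) \<le> 0"
  proof (rule field_le_epsilon)
    fix e :: real assume "0 < e"
    obtain f where f: "continuous_on UNIV f" "l2_norm M (\<lambda>y. g y - f y) < e / 2"
      using continuous_dense[OF g half_gt_zero[OF \<open>0 < e\<close>]] .
    have "cmod (z - w) \<le> cmod (a f - w) + cmod (a f - z)"
      using norm_triangle_ineq4[of "a f - w" "a f - z"] by simp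
    also have "\<dots> \<le> l2_norm M (\<lambda>y. f y - g y) + l2_norm M (\<lambda>y. f y - g y)"
      by (intro add_mono extension_valueD[OF w f(1)] extension_valueD[OF z f(1)])
    also have "\<dots> \<le> 0 + e"
      using f(2) by (simp add: l2_norm_minus_commute[of M f g])
    finally show "cmod (z - w) \<le> 0 + e" .
  qed
  then show ?thesis
    by simp
qed

lemma extension_value_zero: "extension_value (\<lambda>y. 0) 0"
  unfolding extension_value_def using bounded by simp

lemma extension_value_linear:
  assumes z: "extension_value g z" and w: "extension_value h w"
    and g: "g \<in> sq_integrable M" and h: "h \<in> sq_integrable M"
  shows "extension_value (\<lambda>y. g y + c * h y) (z + c * w)"
  unfolding extension_value_def
proof (intro allI impI, rule field_le_epsilon)
  fix f :: "'x \<Rightarrow> complex" and e :: real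
  assume f: "continuous_on UNIV f" and "0 < e"
  \<comment> \<open>Replacing \<open>g\<close> and \<open>h\<close> by continuous functions costs \<open>(1 + cmod c) * \<eta>\<close> twice, in the
    functional and in the norm.\<close>
  define \<eta> where "\<eta> = e / (2 + 2 * cmod c)"
  have "0 < 2 + 2 * cmod c"
    using norm_ge_zero[of c] by linarith
  then have \<eta>: "0 < \<eta>" "\<eta> * (2 + 2 * cmod c) = e"
    using \<open>0 < e\<close> by (simp_all add: \<eta>_def del: distrib_left_numeral)
  obtain g' where g': "continuous_on UNIV g'" "l2_norm M (\<lambda>y. g y - g' y) < \<eta>"
    using continuous_dense[OF g \<eta>(1)] .
  obtain h' where h': "continuous_on UNIV h'" "l2_norm M (\<lambda>y. h y - h' y) < \<eta>"
    using continuous_dense[OF h \<eta>(1)] .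
  have gh': "continuous_on UNIV (\<lambda>y. g' y + c * h' y)"
    by (intro continuous_on_add continuous_on_mult continuous_on_const g' h')
  have 1: "cmod (a g' - z) \<le> \<eta>" "cmod (a h' - w) \<le> \<eta>"
    using extension_valueD[OF z g'(1)] extension_valueD[OF w h'(1)] g'(2) h'(2)
    by (auto simp: l2_norm_minus_commute[of M g'] l2_norm_minus_commute[of M h'])
  have 2: "l2_norm M (\<lambda>y. (g y + c * h y) - (g' y + c * h' y)) \<le> \<eta> + cmod c * \<eta>"
  proof -
    have "l2_norm M (\<lambda>y. (g y - g' y) + c * (h y - h' y))
        \<le> l2_norm M (\<lambda>y. g y - g' y) + l2_norm M (\<lambda>y. c * (h y - h' y))"
      by (intro l2_norm_triangle sq_integrable_scale sq_integrable_diff g h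
          continuous_sq_integrable g'(1) h'(1))
    also have "\<dots> \<le> \<eta> + cmod c * \<eta>"
      unfolding l2_norm_scale using g'(2) h'(2) by (intro add_mono mult_left_mono) auto
    finally show ?thesis
      by (simp add: algebra_simps)
  qed
  have "cmod (a f - (z + c * w))
      = cmod ((a f - a (\<lambda>y. g' y + c * h' y)) + ((a g' - z) + c * (a h' - w)))"
    by (simp add: linear[OF g'(1) h'(1)] algebra_simps)
  also have "\<dots> \<le> cmod (a f - a (\<lambda>y. g' y + c * h' y)) + (cmod (a g' - z) + cmod (c * (a h' - w)))"
    by (intro norm_triangle_le add_left_mono norm_triangle_ineq)
  also have "\<dots> \<le> l2_norm M (\<lambda>y. f y - (g' y + c * h' y)) + (\<eta> + cmod c * \<eta>)"
    unfolding norm_mult using 1 by (intro add_mono functional_lipschitz f gh' mult_left_mono) auto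
  also have "\<dots> \<le> l2_norm M (\<lambda>y. f y - (g y + c * h y)) + (\<eta> + cmod c * \<eta>) + (\<eta> + cmod c * \<eta>)"
  proof -
    have "l2_norm M (\<lambda>y. f y - (g' y + c * h' y)) \<le> l2_norm M (\<lambda>y. f y - (g y + c * h y))
        + l2_norm M (\<lambda>y. (g y + c * h y) - (g' y + c * h' y))"
      by (intro l2_norm_diff_triangle sq_integrable_add sq_integrable_scale g h
          continuous_sq_integrable f g'(1) h'(1))
    then show ?thesis
      using 2 by linarith
  qed
  also have "\<dots> = l2_norm M (\<lambda>y. f y - (g y + c * h y)) + e"
    unfolding \<eta>(2)[symmetric] by (simp add: algebra_simps)
  finally show "cmod (a f - (z + c * w)) \<le> l2_norm M (\<lambda>y. f y - (g y + c * h y)) + e" .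
qed

lemma character_inverse: "\<gamma> s * \<gamma> (- s) = 1"
proof -
  have "\<gamma> (0 + 0) = \<gamma> 0 * \<gamma> 0" "cmod (\<gamma> 0) = 1"
    using character by (simp_all only: dual_group_add dual_group_norm)
  then have "\<gamma> 0 = 1"
    by auto
  moreover have "\<gamma> s * \<gamma> (- s) = \<gamma> (s + - s)"
    by (rule dual_group_add[OF character, symmetric])
  ultimately show ?thesis
    by simp
qed

lemma extension_value_act:
  assumes z: "extension_value g z" and g: "g \<in> sq_integrable M"
  shows "extension_value (\<lambda>y. g (act s y)) (\<gamma> s * z)"
  unfolding extension_value_def
proof (intro allI impI)
  fix f :: "'x \<Rightarrow> complex" assume f: "continuous_on UNIV f"
  let ?f = "\<lambda>y. f (act (- s) y)"
  have f': "continuous_on UNIV ?f"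
    by (rule continuous_act[OF f])
  have "a f = \<gamma> s * a ?f"
    unfolding equivariant[OF f] mult.assoc[symmetric] character_inverse by simp
  then have "a f - \<gamma> s * z = \<gamma> s * (a ?f - z)"
    by (simp only: right_diff_distrib)
  then have "cmod (a f - \<gamma> s * z) = cmod (a ?f - z)"
    by (simp only: norm_mult dual_group_norm[OF character] mult_1_left)
  also have "\<dots> \<le> l2_norm M (\<lambda>y. ?f y - g y)"
    by (rule extension_valueD[OF z f'])
  also have "\<dots> = l2_norm M (\<lambda>y. ?f (act s y) - g (act s y))"
    by (rule l2_norm_act[symmetric])
      (intro sq_integrable_measurable sq_integrable_diff continuous_sq_integrable[OF f'] g)
  also have "\<dots> = l2_norm M (\<lambda>y. f y - g (act s y))"
    by (simp only: act_add[symmetric] left_minus act_zero)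
  finally show "cmod (a f - \<gamma> s * z) \<le> l2_norm M (\<lambda>y. f y - g (act s y))" .
qed

lemma extension_value_cong_AE:
  assumes z: "extension_value g z" and eq: "AE y in M. g y = h y"
    and "g \<in> borel_measurable M" "h \<in> borel_measurable M"
  shows "extension_value h z"
  unfolding extension_value_def
proof (intro allI impI)
  fix f :: "'x \<Rightarrow> complex" assume f: "continuous_on UNIV f"
  have "l2_norm M (\<lambda>y. f y - g y) = l2_norm M (\<lambda>y. f y - h y)"
    using assms continuous_measurable[OF f] by (intro l2_norm_cong_AE) auto
  then show "cmod (a f - z) \<le> l2_norm M (\<lambda>y. f y - h y)"
    using extension_valueD[OF z f] by simp
qed

lemma extension_value_other_eigenfunction:
  assumes z: "extension_value e z" and e: "e \<in> eigenspace act M \<beta>" and "\<beta> \<noteq> \<gamma>"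
  shows "z = 0"
proof -
  obtain s where s: "\<beta> s \<noteq> \<gamma> s"
    using \<open>\<beta> \<noteq> \<gamma>\<close> by blast
  note esq = eigenspace_sq_integrable[OF e]
  have 1: "extension_value (\<lambda>y. \<beta> s * e y) (\<gamma> s * z)"
    by (rule extension_value_cong_AE[OF extension_value_act[OF z esq] eigenspace_act[OF e]])
      (intro sq_integrable_measurable sq_integrable_act sq_integrable_scale esq)+
  have 2: "extension_value (\<lambda>y. \<beta> s * e y) (\<beta> s * z)"
    using extension_value_linear[OF extension_value_zero z sq_integrable_zero esq, of "\<beta> s"] by simp
  have "\<gamma> s * z = \<beta> s * z"
    by (rule extension_value_unique[OF 1 2 sq_integrable_scale[OF esq]])
  then show ?thesis
    using s by simp
qed

lemma extension_value_combination:
  assumes "finite F" and "\<And>\<beta>. \<beta> \<in> F \<Longrightarrow> u \<beta> \<in> sq_integrable M"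
    and "\<And>\<beta>. \<beta> \<in> F \<Longrightarrow> extension_value (u \<beta>) (d \<beta>)"
  shows "extension_value (\<lambda>y. \<Sum>\<beta>\<in>F. c \<beta> * u \<beta> y) (\<Sum>\<beta>\<in>F. c \<beta> * d \<beta>)"
  using assms
proof (induction F)
  case (insert \<beta> F)
  have "extension_value (\<lambda>y. (\<Sum>\<beta>\<in>F. c \<beta> * u \<beta> y) + c \<beta> * u \<beta> y)
      ((\<Sum>\<beta>\<in>F. c \<beta> * d \<beta>) + c \<beta> * d \<beta>)"
    using insert by (intro extension_value_linear sq_integrable_combination) auto
  then show ?case
    using insert.hyps by (simp add: add.commute)
qed (simp add: extension_value_zero)

lemma functional_eq_coefficient:
  assumes pp: "pure_point_spectrum act M" and u: "unit_eigenfunctions u"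
  obtains d where "cmod d \<le> 1"
    "\<And>f. continuous_on UNIV f \<Longrightarrow>
       a f = (if \<gamma> \<in> eigenvalues act M then d * l2_inner M f (u \<gamma>) else 0)"
proof -
  note usq = unit_eigenfunctions_sq_integrable[OF u]
  have "\<exists>d. \<forall>\<beta>\<in>eigenvalues act M. extension_value (u \<beta>) (d \<beta>)"
    by (intro bchoice ballI extension_value_exists usq)
  then obtain d where d: "\<And>\<beta>. \<beta> \<in> eigenvalues act M \<Longrightarrow> extension_value (u \<beta>) (d \<beta>)"
    by blast
  have d_zero: "d \<beta> = 0" if "\<beta> \<in> eigenvalues act M" "\<beta> \<noteq> \<gamma>" for \<beta>
    using u that by (intro extension_value_other_eigenfunction[OF d]) (auto simp: unit_eigenfunctions_def)
  define D where "D = (if \<gamma> \<in> eigenvalues act M then d \<gamma> else 0)"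
  have D_le: "cmod D \<le> 1"
  proof (cases "\<gamma> \<in> eigenvalues act M")
    case True
    have "cmod (a (\<lambda>y. 0) - d \<gamma>) \<le> l2_norm M (\<lambda>y. 0 - u \<gamma> y)"
      by (rule extension_valueD[OF d[OF True] continuous_on_const])
    moreover have "a (\<lambda>y. 0) = 0"
      using linear[OF continuous_on_const continuous_on_const, of 0 1 0] by simp
    moreover have "l2_norm M (\<lambda>y. 0 - u \<gamma> y) = l2_norm M (u \<gamma>)"
      by (simp add: l2_norm_def)
    ultimately show ?thesis
      using u True by (simp add: D_def unit_eigenfunctions_def)
  qed (simp add: D_def)
  define coeff where "coeff g = (if \<gamma> \<in> eigenvalues act M then D * l2_inner M g (u \<gamma>) else 0)" for g
  have "a f = coeff f" if f: "continuous_on UNIV f" for f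
  proof -
    note fsq = continuous_sq_integrable[OF f]
    have "cmod (a f - coeff f) \<le> 0"
    proof (rule field_le_epsilon)
      fix e :: real assume "0 < e"
      obtain F c where F: "finite F" "F \<subseteq> eigenvalues act M"
        and approx: "l2_norm M (\<lambda>y. f y - (\<Sum>\<beta>\<in>F. c \<beta> * u \<beta> y)) < e / 2"
        using pure_point_approximation[OF pp u fsq half_gt_zero[OF \<open>0 < e\<close>]] .
      define g where "g y = (\<Sum>\<beta>\<in>F. c \<beta> * u \<beta> y)" for y
      have uF: "u \<beta> \<in> sq_integrable M" if "\<beta> \<in> F" for \<beta>
        using usq F(2) that by blast
      have g: "g \<in> sq_integrable M"
        unfolding g_def by (intro sq_integrable_combination uF)
      have sum: "(\<Sum>\<beta>\<in>F. c \<beta> * d \<beta>) = coeff g"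
      proof (cases "\<gamma> \<in> eigenvalues act M")
        case True
        have "l2_inner M g (u \<gamma>) = (\<Sum>\<beta>\<in>F. c \<beta> * l2_inner M (u \<beta>) (u \<gamma>))"
          unfolding g_def by (intro l2_inner_combination_left uF usq True)
        then have "coeff g = (\<Sum>\<beta>\<in>F. c \<beta> * (D * l2_inner M (u \<beta>) (u \<gamma>)))"
          using True by (simp add: coeff_def sum_distrib_left mult.left_commute)
        also have "\<dots> = (\<Sum>\<beta>\<in>F. c \<beta> * d \<beta>)"
        proof (intro sum.cong refl arg_cong2[where f = times])
          fix \<beta> assume "\<beta> \<in> F"
          then show "D * l2_inner M (u \<beta>) (u \<gamma>) = d \<beta>"
            using F(2) True d_zero[of \<beta>] unit_eigenfunctions_orthonormal[OF u, of \<beta> \<gamma>]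
            by (auto simp: D_def)
        qed
        finally show ?thesis ..
      next
        case False
        then have "c \<beta> * d \<beta> = 0" if "\<beta> \<in> F" for \<beta>
          using d_zero[of \<beta>] that F(2) by auto
        then have "(\<Sum>\<beta>\<in>F. c \<beta> * d \<beta>) = 0"
          by (intro sum.neutral ballI)
        then show ?thesis
          using False by (simp add: coeff_def)
      qed
      have "cmod (coeff g - coeff f) \<le> e / 2"
      proof (cases "\<gamma> \<in> eigenvalues act M")
        case True
        have "coeff g - coeff f = D * l2_inner M (\<lambda>y. g y - f y) (u \<gamma>)"
          using True by (simp add: coeff_def l2_inner_diff_left g usq fsq right_diff_distrib)
        then have "cmod (coeff g - coeff f) = cmod D * cmod (l2_inner M (\<lambda>y. g y - f y) (u \<gamma>))"
          by (simp only: norm_mult)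
        also have "\<dots> \<le> 1 * (l2_norm M (\<lambda>y. g y - f y) * l2_norm M (u \<gamma>))"
          by (intro mult_mono D_le l2_cauchy_schwarz sq_integrable_diff g fsq usq True) auto
        also have "\<dots> \<le> e / 2"
        proof -
          have "l2_norm M (\<lambda>y. g y - f y) < e / 2"
            unfolding l2_norm_minus_commute[of M g f] using approx unfolding g_def .
          then show ?thesis
            using u True by (simp add: unit_eigenfunctions_def)
        qed
        finally show ?thesis .
      qed (use \<open>0 < e\<close> in \<open>simp add: coeff_def\<close>)
      moreover have "cmod (a f - coeff g) \<le> l2_norm M (\<lambda>y. f y - g y)"
        unfolding sum[symmetric] g_def using F(2)
        by (intro extension_valueD[OF extension_value_combination f] F(1) uF d) auto
      then have "cmod (a f - coeff g) \<le> e / 2"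
        using approx by (simp add: g_def)
      ultimately show "cmod (a f - coeff f) \<le> 0 + e"
        using norm_triangle_ineq[of "a f - coeff g" "coeff g - coeff f"] by simp
    qed
    then show ?thesis
      by simp
  qed
  then show ?thesis
    using that[OF D_le] unfolding coeff_def by blast
qed

end

section \<open>Wiener--Wintner points\<close>

locale ergodic_system_with_means = ergodic_system M act + F: folner \<mu> A
  for M :: "'x::t2_space measure"
    and act :: "'g::{topological_ab_group_add, t2_space} \<Rightarrow> 'x \<Rightarrow> 'x"
    and \<mu> :: "'g measure" and A :: "nat \<Rightarrow> 'g set" +
  fixes x :: 'x
  assumes pure_point: "pure_point_spectrum act M"
begin

abbreviation orbit :: "('x \<Rightarrow> complex) \<Rightarrow> 'g \<Rightarrow> complex" where
  "orbit f \<equiv> \<lambda>t. f (act t x)"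

lemma orbit_measurable: "continuous_on UNIV f \<Longrightarrow> orbit f \<in> borel_measurable \<mu>"
  by (rule F.continuous_measurable[OF continuous_along_orbit])

lemma orbit_sq_integrable:
  assumes f: "continuous_on UNIV f"
  shows "orbit f \<in> sq_integrable (F.P n)"
proof -
  obtain C where "\<forall>y. cmod (f y) \<le> C"
    using continuous_bounded[OF f] by blast
  then show ?thesis
    by (intro F.bounded_sq_integrable_P[OF orbit_measurable[OF f]]) blast
qed

lemma average_orbit_mult_cnj:
  assumes "continuous_on UNIV f" and "\<gamma> \<in> dual_group"
  shows "average \<mu> (A n) (\<lambda>t. f (act t x) * cnj (\<gamma> t)) = l2_inner (F.P n) (orbit f) \<gamma>"
  by (intro F.average_mult_cnj orbit_measurable F.continuous_measurable dual_group_continuous assms)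

lemma generic_point_orbit_norm:
  assumes gen: "generic_point \<mu> A act M x" and f: "continuous_on UNIV f"
  shows "(\<lambda>n. (l2_norm (F.P n) (orbit f))\<^sup>2) \<longlonglongrightarrow> (l2_norm M f)\<^sup>2"
proof -
  have "continuous_on UNIV (\<lambda>y. f y * cnj (f y))"
    by (intro continuous_on_mult continuous_on_cnj f)
  then have "(\<lambda>n. average \<mu> (A n) (\<lambda>t. f (act t x) * cnj (f (act t x)))) \<longlonglongrightarrow> l2_inner M f f"
    unfolding l2_inner_def by (rule gen[unfolded generic_point_def, rule_format])
  then have "(\<lambda>n. complex_of_real ((l2_norm (F.P n) (orbit f))\<^sup>2)) \<longlonglongrightarrow> complex_of_real ((l2_norm M f)\<^sup>2)"
    by (simp only: F.average_mult_cnj[OF orbit_measurable[OF f] orbit_measurable[OF f]] l2_inner_self)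
  then show ?thesis
    by (simp only: tendsto_of_real_iff)
qed

subsection \<open>From Wiener--Wintner points to genericity and almost periodicity\<close>

text \<open>This replaces the set of eigenfunctions in the definition by a family indexed by the
  eigenvalues, to which Bessel's identity applies.\<close>

lemma wiener_wintner_point_coefficients:
  assumes "wiener_wintner_point \<mu> A act M x"
  obtains u where "unit_eigenfunctions u"
    "\<forall>f. continuous_on UNIV f \<longrightarrow> (\<forall>\<gamma>\<in>eigenvalues act M.
       (\<lambda>n. l2_inner (F.P n) (orbit f) \<gamma>) \<longlonglongrightarrow> l2_inner M f (u \<gamma>))"
proof -
  obtain B where
    basis: "\<forall>\<gamma>\<in>eigenvalues act M.
       orthonormal_basis_of M {e \<in> B. eigenfunction act M \<gamma> e} (eigenspace act M \<gamma>)"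
    and lim: "\<forall>f. continuous_on UNIV f \<longrightarrow>
       (\<forall>e\<in>B. \<forall>\<gamma>. eigenfunction act M \<gamma> e \<longrightarrow>
         (\<lambda>n. average \<mu> (A n) (\<lambda>t. f (act t x) * cnj (\<gamma> t))) \<longlonglongrightarrow> l2_inner M f e)"
    using assms unfolding wiener_wintner_point_def by (elim exE conjE)
  have "\<exists>e. e \<in> B \<and> eigenfunction act M \<gamma> e" if "\<gamma> \<in> eigenvalues act M" for \<gamma>
    using orthonormal_basis_of_eigenspace_nonempty[OF that bspec[OF basis that]] by blast
  then obtain u where u: "\<And>\<gamma>. \<gamma> \<in> eigenvalues act M \<Longrightarrow> u \<gamma> \<in> B"
    "\<And>\<gamma>. \<gamma> \<in> eigenvalues act M \<Longrightarrow> eigenfunction act M \<gamma> (u \<gamma>)"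
    by metis
  have norm1: "l2_norm M (u \<gamma>) = 1" if "\<gamma> \<in> eigenvalues act M" for \<gamma>
  proof -
    have "l2_inner M (u \<gamma>) (u \<gamma>) = 1"
      using bspec[OF basis that] u[OF that] by (simp add: orthonormal_basis_of_def)
    then have "(l2_norm M (u \<gamma>))\<^sup>2 = 1"
      unfolding l2_inner_self by (simp only: of_real_eq_1_iff)
    then show ?thesis
      using l2_norm_nonneg[of M "u \<gamma>"] by (simp add: power2_eq_1_iff)
  qed
  have "unit_eigenfunctions u"
    using u(2) norm1 by (auto simp: unit_eigenfunctions_def eigenfunction_def)
  moreover have "(\<lambda>n. l2_inner (F.P n) (orbit f) \<gamma>) \<longlonglongrightarrow> l2_inner M f (u \<gamma>)"
    if "continuous_on UNIV f" "\<gamma> \<in> eigenvalues act M" for f \<gamma>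
    using lim[rule_format, OF that(1) u(1)[OF that(2)] u(2)[OF that(2)]]
    by (simp only: average_orbit_mult_cnj[OF that(1) eigenvalues_dual_group[OF that(2)]])
  ultimately show ?thesis
    using that by blast
qed

text \<open>The eigenfunction chosen for the trivial character is a constant of modulus one; testing it
  against the constant function 1 shows that this constant is 1, not just a phase.\<close>

lemma wiener_wintner_point_imp_generic_point:
  assumes "wiener_wintner_point \<mu> A act M x"
  shows "generic_point \<mu> A act M x"
proof -
  obtain u where u: "unit_eigenfunctions u"
    and lim: "\<forall>f. continuous_on UNIV f \<longrightarrow> (\<forall>\<gamma>\<in>eigenvalues act M.
       (\<lambda>n. l2_inner (F.P n) (orbit f) \<gamma>) \<longlonglongrightarrow> l2_inner M f (u \<gamma>))"
    using wiener_wintner_point_coefficients[OF assms] .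
  define e where "e = u (\<lambda>t. 1)"
  have e: "e \<in> eigenspace act M (\<lambda>t. 1)"
    using u trivial_character_eigenvalue by (simp add: e_def unit_eigenfunctions_def)
  have e_meas: "e \<in> borel_measurable M"
    by (rule sq_integrable_measurable[OF eigenspace_sq_integrable[OF e]])
  define c where "c = l2_inner M e (\<lambda>y. 1)"
  have ec: "AE y in M. e y = c"
    using eigenspace_one_dimensional[OF trivial_character constant_eigenfunction e] by (simp add: c_def)
  have inner_e: "l2_inner M f e = cnj c * (LINT y|M. f y)" if f: "continuous_on UNIV f" for f
  proof -
    have "l2_inner M f e = l2_inner M f (\<lambda>y. c)"
      using ec continuous_measurable[OF f] e_meas by (intro l2_inner_cong_AE) auto
    then show ?thesis
      by (simp add: l2_inner_def)
  qed
  have "(\<lambda>n. l2_inner (F.P n) (orbit (\<lambda>y. 1)) (\<lambda>t. 1)) \<longlonglongrightarrow> l2_inner M (\<lambda>y. 1) e"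
    unfolding e_def by (rule lim[rule_format, OF continuous_on_const trivial_character_eigenvalue])
  moreover have "l2_inner (F.P n) (orbit (\<lambda>y. 1)) (\<lambda>t. 1) = 1" for n
  proof -
    interpret P: prob_space "F.P n"
      by (rule F.prob_space_P)
    show ?thesis
      by (simp add: l2_inner_def P.prob_space)
  qed
  ultimately have "(\<lambda>n. 1) \<longlonglongrightarrow> l2_inner M (\<lambda>y. 1) e"
    by simp
  then have "l2_inner M (\<lambda>y. 1) e = 1"
    by (rule LIMSEQ_unique) (rule tendsto_const)
  moreover have "prob UNIV = 1"
    using prob_space by simp
  ultimately have "cnj c = 1"
    by (simp add: inner_e continuous_on_const)
  show ?thesis
    unfolding generic_point_def
  proof (intro allI impI)
    fix f :: "'x \<Rightarrow> complex" assume f: "continuous_on UNIV f"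
    have "(\<lambda>n. average \<mu> (A n) (\<lambda>t. f (act t x) * cnj 1)) \<longlonglongrightarrow> l2_inner M f e"
      unfolding average_orbit_mult_cnj[OF f trivial_character] e_def
      by (rule lim[rule_format, OF f trivial_character_eigenvalue])
    then show "(\<lambda>n. average \<mu> (A n) (\<lambda>t. f (act t x))) \<longlonglongrightarrow> (LINT y|M. f y)"
      using \<open>cnj c = 1\<close> by (simp add: inner_e[OF f])
  qed
qed

lemma wiener_wintner_point_imp_besicovitch_ap_point:
  assumes "wiener_wintner_point \<mu> A act M x"
  shows "besicovitch_ap_point \<mu> A act x"
  unfolding besicovitch_ap_point_def
proof (intro allI impI)
  fix f :: "'x \<Rightarrow> complex" assume f: "continuous_on UNIV f"
  obtain u where u: "unit_eigenfunctions u"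
    and lim: "\<forall>f. continuous_on UNIV f \<longrightarrow> (\<forall>\<gamma>\<in>eigenvalues act M.
       (\<lambda>n. l2_inner (F.P n) (orbit f) \<gamma>) \<longlonglongrightarrow> l2_inner M f (u \<gamma>))"
    using wiener_wintner_point_coefficients[OF assms] .
  obtain C where C: "\<forall>y. cmod (f y) \<le> C"
    using continuous_bounded[OF f] by blast
  have parseval: "\<exists>F\<subseteq>eigenvalues act M. finite F \<and>
      (l2_norm M f)\<^sup>2 - (\<Sum>\<gamma>\<in>F. (cmod (l2_inner M f (u \<gamma>)))\<^sup>2) < \<epsilon>" if "0 < \<epsilon>" for \<epsilon>
  proof -
    have "0 < sqrt \<epsilon>"
      using that by simp
    then obtain F c where F: "finite F" "F \<subseteq> eigenvalues act M"
      and approx: "l2_norm M (\<lambda>y. f y - (\<Sum>\<gamma>\<in>F. c \<gamma> * u \<gamma> y)) < sqrt \<epsilon>"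
      using pure_point_approximation[OF pure_point u continuous_sq_integrable[OF f]] by blast
    have "(l2_norm M (\<lambda>y. f y - (\<Sum>\<gamma>\<in>F. c \<gamma> * u \<gamma> y)))\<^sup>2 < (sqrt \<epsilon>)\<^sup>2"
      by (rule power_strict_mono[OF approx]) simp_all
    then have "(l2_norm M f)\<^sup>2 - (\<Sum>\<gamma>\<in>F. (cmod (l2_inner M f (u \<gamma>)))\<^sup>2) < \<epsilon>"
      using unit_eigenfunctions_expansion[OF u continuous_sq_integrable[OF f] F, of c] that
        sum_nonneg[of F "\<lambda>\<gamma>. (cmod (c \<gamma> - l2_inner M f (u \<gamma>)))\<^sup>2"]
      by simp
    then show ?thesis
      using F by blast
  qed
  show "besicovitch_ap_function \<mu> A (orbit f)"
  proof (rule F.besicovitch_ap_functionI[OF orbit_measurable[OF f] _ lim[rule_format, OF f]])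
    show "cmod (f (act t x)) \<le> C" for t
      using C by blast
    show "eigenvalues act M \<subseteq> dual_group"
      using eigenvalues_dual_group by blast
    show "(\<lambda>n. (l2_norm (F.P n) (orbit f))\<^sup>2) \<longlonglongrightarrow> (l2_norm M f)\<^sup>2"
      by (rule generic_point_orbit_norm[OF wiener_wintner_point_imp_generic_point[OF assms] f])
  qed (use parseval in auto)
qed

subsection \<open>From genericity and almost periodicity to Wiener--Wintner points\<close>

definition orbit_coefficient :: "('g \<Rightarrow> complex) \<Rightarrow> ('x \<Rightarrow> complex) \<Rightarrow> complex" where
  "orbit_coefficient \<gamma> f = lim (\<lambda>n. l2_inner (F.P n) (orbit f) \<gamma>)"

lemma orbit_coefficient_limit:
  assumes "besicovitch_ap_point \<mu> A act x" and f: "continuous_on UNIV f" and \<gamma>: "\<gamma> \<in> dual_group"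
  shows "(\<lambda>n. l2_inner (F.P n) (orbit f) \<gamma>) \<longlonglongrightarrow> orbit_coefficient \<gamma> f"
proof -
  have "besicovitch_ap_function \<mu> A (orbit f)"
    using assms(1) f unfolding besicovitch_ap_point_def by blast
  then show ?thesis
    unfolding orbit_coefficient_def
    using F.besicovitch_ap_function_coefficient_exists[OF _ \<gamma>] by (simp add: convergent_LIMSEQ_iff)
qed

text \<open>Genericity makes the coefficient functional bounded by the \<open>L\<^sup>2\<close> norm, and
  asymptotic translation invariance of the means makes it equivariant.\<close>

lemma orbit_coefficient_equivariant_functional:
  assumes gen: "generic_point \<mu> A act M x" and bap: "besicovitch_ap_point \<mu> A act x"
    and \<gamma>: "\<gamma> \<in> dual_group"
  shows "equivariant_functional M act (orbit_coefficient \<gamma>) \<gamma>"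
proof
  note lim = orbit_coefficient_limit[OF bap _ \<gamma>]
  note \<gamma>_sq = F.dual_group_sq_integrable_P[OF \<gamma>]
  show "orbit_coefficient \<gamma> (\<lambda>y. f y + c * g y) = orbit_coefficient \<gamma> f + c * orbit_coefficient \<gamma> g"
    if f: "continuous_on UNIV f" and g: "continuous_on UNIV g" for f g c
  proof (rule LIMSEQ_unique)
    show "(\<lambda>n. l2_inner (F.P n) (orbit (\<lambda>y. f y + c * g y)) \<gamma>) \<longlonglongrightarrow> orbit_coefficient \<gamma> (\<lambda>y. f y + c * g y)"
      by (intro lim continuous_on_add continuous_on_mult continuous_on_const f g)
    have "l2_inner (F.P n) (orbit (\<lambda>y. f y + c * g y)) \<gamma>
        = l2_inner (F.P n) (orbit f) \<gamma> + c * l2_inner (F.P n) (orbit g) \<gamma>" for n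
      using l2_inner_add_left[OF orbit_sq_integrable[OF f] sq_integrable_scale[OF orbit_sq_integrable[OF g]] \<gamma>_sq]
      by (simp only: l2_inner_scale_left)
    then show "(\<lambda>n. l2_inner (F.P n) (orbit (\<lambda>y. f y + c * g y)) \<gamma>) \<longlonglongrightarrow>
        orbit_coefficient \<gamma> f + c * orbit_coefficient \<gamma> g"
      by (simp only:) (intro tendsto_add tendsto_mult tendsto_const lim f g)
  qed
  show "cmod (orbit_coefficient \<gamma> f) \<le> l2_norm M f" if f: "continuous_on UNIV f" for f
  proof (rule LIMSEQ_le)
    show "(\<lambda>n. cmod (l2_inner (F.P n) (orbit f) \<gamma>)) \<longlonglongrightarrow> cmod (orbit_coefficient \<gamma> f)"
      by (rule tendsto_norm[OF lim[OF f]])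
    show "(\<lambda>n. l2_norm (F.P n) (orbit f)) \<longlonglongrightarrow> l2_norm M f"
      using tendsto_real_sqrt[OF generic_point_orbit_norm[OF gen f]] by (simp add: real_sqrt_abs)
    show "\<exists>N. \<forall>n\<ge>N. cmod (l2_inner (F.P n) (orbit f) \<gamma>) \<le> l2_norm (F.P n) (orbit f)"
      using F.l2_inner_character_bound[OF orbit_sq_integrable[OF f] \<gamma>] by blast
  qed
  show "orbit_coefficient \<gamma> (\<lambda>y. f (act s y)) = \<gamma> s * orbit_coefficient \<gamma> f"
    if f: "continuous_on UNIV f" for f s
  proof (rule LIMSEQ_unique)
    define k where "k t = f (act t x) * cnj (\<gamma> t)" for t
    have k_cont: "continuous_on UNIV k"
      unfolding k_def by (intro continuous_on_mult continuous_on_cnj continuous_along_orbit f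
          dual_group_continuous \<gamma>)
    obtain C where C: "\<forall>y. cmod (f y) \<le> C"
      using continuous_bounded[OF f] by blast
    have k_bound: "cmod (k t) \<le> C" for t
      using C by (simp add: k_def norm_mult dual_group_norm[OF \<gamma>])
    have "(\<lambda>n. average \<mu> (A n) (\<lambda>t. k (s + t)) - average \<mu> (A n) k) \<longlonglongrightarrow> 0"
      by (rule F.average_shift[OF F.continuous_measurable[OF k_cont] k_bound])
    moreover have "(\<lambda>n. average \<mu> (A n) k) \<longlonglongrightarrow> orbit_coefficient \<gamma> f"
      unfolding k_def average_orbit_mult_cnj[OF f \<gamma>] by (rule lim[OF f])
    ultimately have "(\<lambda>n. (average \<mu> (A n) (\<lambda>t. k (s + t)) - average \<mu> (A n) k) + average \<mu> (A n) k)
        \<longlonglongrightarrow> 0 + orbit_coefficient \<gamma> f"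
      by (rule tendsto_add)
    then have "(\<lambda>n. \<gamma> s * average \<mu> (A n) (\<lambda>t. k (s + t))) \<longlonglongrightarrow> \<gamma> s * orbit_coefficient \<gamma> f"
      by (intro tendsto_mult tendsto_const) simp
    moreover have "\<gamma> s * average \<mu> (A n) (\<lambda>t. k (s + t))
        = l2_inner (F.P n) (orbit (\<lambda>y. f (act s y))) \<gamma>" for n
    proof -
      have "\<gamma> s * k (s + t) = f (act s (act t x)) * cnj (\<gamma> t)" for t
      proof -
        have "\<gamma> s * k (s + t) = (\<gamma> s * cnj (\<gamma> s)) * (f (act s (act t x)) * cnj (\<gamma> t))"
          unfolding k_def dual_group_add[OF \<gamma>] act_add complex_cnj_mult by (simp only: mult_ac)
        then show ?thesis
          unfolding dual_group_mult_cnj[OF \<gamma>] by simp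
      qed
      then show ?thesis
        unfolding F.average_scale[symmetric] average_orbit_mult_cnj[OF continuous_act[OF f] \<gamma>, symmetric]
        by simp
    qed
    ultimately show "(\<lambda>n. l2_inner (F.P n) (orbit (\<lambda>y. f (act s y))) \<gamma>) \<longlonglongrightarrow> \<gamma> s * orbit_coefficient \<gamma> f"
      by (simp only:)
    show "(\<lambda>n. l2_inner (F.P n) (orbit (\<lambda>y. f (act s y))) \<gamma>) \<longlonglongrightarrow> orbit_coefficient \<gamma> (\<lambda>y. f (act s y))"
      by (rule lim[OF continuous_act[OF f]])
  qed
qed (rule \<gamma>)

text \<open>By Parseval's identity for the almost periodic function \<open>orbit f\<close>, no mass may be lost
  in passing from the Fourier coefficients of \<open>f\<close> to those of its orbit; so the factors
  between the two have modulus one.\<close>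

lemma coefficient_factor_unimodular:
  assumes gen: "generic_point \<mu> A act M x" and bap: "besicovitch_ap_point \<mu> A act x"
    and u: "unit_eigenfunctions u"
    and d_le: "\<And>\<gamma>. \<gamma> \<in> dual_group \<Longrightarrow> cmod (d \<gamma>) \<le> 1"
    and d: "\<And>\<gamma> f. \<gamma> \<in> dual_group \<Longrightarrow> continuous_on UNIV f \<Longrightarrow> orbit_coefficient \<gamma> f =
       (if \<gamma> \<in> eigenvalues act M then d \<gamma> * l2_inner M f (u \<gamma>) else 0)"
    and \<beta>: "\<beta> \<in> eigenvalues act M"
  shows "cmod (d \<beta>) = 1"
proof (rule ccontr)
  assume "cmod (d \<beta>) \<noteq> 1"
  then have "cmod (d \<beta>) < 1"
    using d_le[OF eigenvalues_dual_group[OF \<beta>]] by simp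
  then have d2: "(cmod (d \<beta>))\<^sup>2 < 1"
    by (simp add: abs_square_less_1)
  note usq = unit_eigenfunctions_sq_integrable[OF u \<beta>]
  \<comment> \<open>A continuous function close to \<open>u \<beta>\<close> has a nonzero coefficient at \<open>\<beta>\<close>.\<close>
  obtain f where f: "continuous_on UNIV f" and close: "l2_norm M (\<lambda>y. u \<beta> y - f y) < 1"
    using continuous_dense[OF usq zero_less_one] .
  note fsq = continuous_sq_integrable[OF f]
  define b where "b \<gamma> = (cmod (l2_inner M f (u \<gamma>)))\<^sup>2" for \<gamma>
  have "cmod (l2_inner M (\<lambda>y. u \<beta> y - f y) (u \<beta>)) \<le> l2_norm M (\<lambda>y. u \<beta> y - f y) * l2_norm M (u \<beta>)"
    by (intro l2_cauchy_schwarz sq_integrable_diff usq fsq)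
  also have "\<dots> < 1"
    using close u \<beta> by (simp add: unit_eigenfunctions_def)
  finally have "cmod (1 - l2_inner M f (u \<beta>)) < 1"
    by (simp add: l2_inner_diff_left usq fsq unit_eigenfunctions_orthonormal[OF u \<beta> \<beta>])
  then have "0 < b \<beta>"
    by (auto simp: b_def)
  \<comment> \<open>The mass of \<open>f\<close> at \<open>\<beta>\<close> that the orbit function does not see.\<close>
  define \<delta> where "\<delta> = (1 - (cmod (d \<beta>))\<^sup>2) * b \<beta>"
  have \<delta>: "0 < \<delta>"
    using d2 \<open>0 < b \<beta>\<close> by (simp add: \<delta>_def)
  have ap: "besicovitch_ap_function \<mu> A (orbit f)"
    using bap f unfolding besicovitch_ap_point_def by blast
  obtain F where F: "finite F" "F \<subseteq> dual_group"
    and parseval: "(l2_norm M f)\<^sup>2 \<le> (\<Sum>\<gamma>\<in>F. (cmod (orbit_coefficient \<gamma> f))\<^sup>2) + \<delta> / 2"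
    using F.besicovitch_ap_function_parseval[OF ap orbit_coefficient_limit[OF bap f]
        generic_point_orbit_norm[OF gen f] half_gt_zero[OF \<delta>]] by blast
  \<comment> \<open>Including \<open>\<beta>\<close> makes the lost mass appear in the sum, and dropping characters that are not
    eigenvalues makes Bessel's inequality applicable.\<close>
  define F' where "F' = insert \<beta> (F \<inter> eigenvalues act M)"
  have F': "finite F'" "\<beta> \<in> F'" "F' \<subseteq> eigenvalues act M"
    using F(1) \<beta> by (auto simp: F'_def)
  have "(\<Sum>\<gamma>\<in>F. (cmod (orbit_coefficient \<gamma> f))\<^sup>2)
      = (\<Sum>\<gamma>\<in>F \<inter> eigenvalues act M. (cmod (orbit_coefficient \<gamma> f))\<^sup>2)"
  proof (intro sum.mono_neutral_right F(1) Int_lower1 ballI)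
    fix \<gamma> assume "\<gamma> \<in> F - F \<inter> eigenvalues act M"
    then have "\<gamma> \<in> dual_group" "\<gamma> \<notin> eigenvalues act M"
      using F(2) by auto
    then show "(cmod (orbit_coefficient \<gamma> f))\<^sup>2 = 0"
      by (simp add: d[OF _ f])
  qed
  also have "\<dots> \<le> (\<Sum>\<gamma>\<in>F'. (cmod (orbit_coefficient \<gamma> f))\<^sup>2)"
    using F'(1) by (intro sum_mono2) (auto simp: F'_def)
  also have "\<dots> = (\<Sum>\<gamma>\<in>F'. (cmod (d \<gamma>))\<^sup>2 * b \<gamma>)"
  proof (rule sum.cong[OF refl])
    fix \<gamma> assume "\<gamma> \<in> F'"
    then have "\<gamma> \<in> eigenvalues act M"
      using F'(3) by blast
    then show "(cmod (orbit_coefficient \<gamma> f))\<^sup>2 = (cmod (d \<gamma>))\<^sup>2 * b \<gamma>"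
      using d[OF eigenvalues_dual_group f, of \<gamma>] by (simp add: b_def norm_mult power_mult_distrib)
  qed
  finally have 1: "(\<Sum>\<gamma>\<in>F. (cmod (orbit_coefficient \<gamma> f))\<^sup>2) \<le> (\<Sum>\<gamma>\<in>F'. (cmod (d \<gamma>))\<^sup>2 * b \<gamma>)" .
  have "\<delta> \<le> (\<Sum>\<gamma>\<in>F'. (1 - (cmod (d \<gamma>))\<^sup>2) * b \<gamma>)"
    unfolding \<delta>_def
  proof (rule member_le_sum[OF F'(2) _ F'(1)])
    fix \<gamma> assume "\<gamma> \<in> F' - {\<beta>}"
    then have "cmod (d \<gamma>) \<le> 1"
      using F'(3) by (intro d_le eigenvalues_dual_group) blast
    then have "(cmod (d \<gamma>))\<^sup>2 \<le> 1"
      by (simp add: power_le_one)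
    then show "0 \<le> (1 - (cmod (d \<gamma>))\<^sup>2) * b \<gamma>"
      by (simp add: b_def)
  qed
  also have "\<dots> = (\<Sum>\<gamma>\<in>F'. b \<gamma>) - (\<Sum>\<gamma>\<in>F'. (cmod (d \<gamma>))\<^sup>2 * b \<gamma>)"
    by (simp add: left_diff_distrib sum_subtractf)
  also have "(\<Sum>\<gamma>\<in>F'. b \<gamma>) \<le> (l2_norm M f)\<^sup>2"
    unfolding b_def by (rule bessel[OF u fsq F'(1,3)])
  finally show False
    using 1 parseval \<delta> by simp
qed

lemma generic_besicovitch_ap_imp_wiener_wintner_point:
  assumes gen: "generic_point \<mu> A act M x" and bap: "besicovitch_ap_point \<mu> A act x"
  shows "wiener_wintner_point \<mu> A act M x"
proof -
  obtain u where u: "unit_eigenfunctions u"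
    using ex_unit_eigenfunctions by blast
  have "\<exists>d. cmod d \<le> 1 \<and> (\<forall>f :: 'x \<Rightarrow> complex. continuous_on UNIV f \<longrightarrow> orbit_coefficient \<gamma> f =
      (if \<gamma> \<in> eigenvalues act M then d * l2_inner M f (u \<gamma>) else 0))" if "\<gamma> \<in> dual_group" for \<gamma>
    using equivariant_functional.functional_eq_coefficient[
        OF orbit_coefficient_equivariant_functional[OF gen bap that] pure_point u] by metis
  then obtain d where d_le: "\<And>\<gamma>. \<gamma> \<in> dual_group \<Longrightarrow> cmod (d \<gamma>) \<le> 1"
    and d: "\<And>\<gamma> f. \<gamma> \<in> dual_group \<Longrightarrow> continuous_on UNIV f \<Longrightarrow> orbit_coefficient \<gamma> f =
       (if \<gamma> \<in> eigenvalues act M then d \<gamma> * l2_inner M f (u \<gamma>) else 0)"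
    by metis
  \<comment> \<open>Rotating the unit eigenfunctions absorbs the unimodular factors.\<close>
  define e where "e \<gamma> = (\<lambda>y. cnj (d \<gamma>) * u \<gamma> y)" for \<gamma>
  have e: "e \<gamma> \<in> eigenspace act M \<gamma>" "l2_norm M (e \<gamma>) = 1" if "\<gamma> \<in> eigenvalues act M" for \<gamma>
  proof -
    show "e \<gamma> \<in> eigenspace act M \<gamma>"
      unfolding e_def using u that by (intro eigenspace_scale) (simp add: unit_eigenfunctions_def)
    have "cmod (d \<gamma>) = 1"
      by (rule coefficient_factor_unimodular[OF gen bap u d_le d that])
    then show "l2_norm M (e \<gamma>) = 1"
      unfolding e_def l2_norm_scale using u that by (simp add: unit_eigenfunctions_def)
  qed
  have eig: "eigenfunction act M \<gamma> (e \<gamma>)" if "\<gamma> \<in> eigenvalues act M" for \<gamma>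
    by (rule unit_eigenfunction[OF e(1)[OF that] eigenvalues_dual_group[OF that] e(2)[OF that]])
  define B where "B = e ` eigenvalues act M"
  show ?thesis
    unfolding wiener_wintner_point_def
  proof (intro exI[of _ B] conjI ballI allI impI)
    fix b assume "b \<in> B"
    then show "\<exists>\<gamma>. eigenfunction act M \<gamma> b"
      using eig by (auto simp: B_def)
  next
    fix \<gamma> assume \<gamma>: "\<gamma> \<in> eigenvalues act M"
    have "{b \<in> B. eigenfunction act M \<gamma> b} = {e \<gamma>}"
      using eig eigenfunction_unique_character \<gamma> by (auto simp: B_def)
    then show "orthonormal_basis_of M {b \<in> B. eigenfunction act M \<gamma> b} (eigenspace act M \<gamma>)"
      using unit_eigenfunction_orthonormal_basis[OF eigenvalues_dual_group[OF \<gamma>] e[OF \<gamma>]] by simp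
  next
    fix f b :: "'x \<Rightarrow> complex" and \<gamma>
    assume f: "continuous_on UNIV f" and "b \<in> B" and "eigenfunction act M \<gamma> b"
    then have \<gamma>: "\<gamma> \<in> eigenvalues act M" and b: "b = e \<gamma>"
      using eig eigenfunction_unique_character by (auto simp: B_def eigenvalues_def)
    note \<gamma>' = eigenvalues_dual_group[OF \<gamma>]
    have "orbit_coefficient \<gamma> f = l2_inner M f b"
      unfolding b e_def l2_inner_scale_right using d[OF \<gamma>' f] \<gamma> by simp
    then show "(\<lambda>n. average \<mu> (A n) (\<lambda>t. f (act t x) * cnj (\<gamma> t))) \<longlonglongrightarrow> l2_inner M f b"
      using orbit_coefficient_limit[OF bap f \<gamma>'] unfolding average_orbit_mult_cnj[OF f \<gamma>'] by simp
  qed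
qed

end

theorem theorem6p4:
  fixes \<mu> :: "'g::{topological_ab_group_add, t2_space} measure"
    and act :: "'g \<Rightarrow> 'x::t2_space \<Rightarrow> 'x"
    and m :: "'x measure"
    and A :: "nat \<Rightarrow> 'g set"
    and x :: 'x
  assumes "locally compact (UNIV :: 'g set)"
    and "sigma_compact_space TYPE('g)"
    and "haar_measure \<mu>"
    and "topological_dynamical_system act"
    and "invariant_probability_measure act m"
    and "ergodic_measure act m"
    and "pure_point_spectrum act m"
    and "folner_sequence \<mu> A"
  shows "wiener_wintner_point \<mu> A act m x \<longleftrightarrow>
           generic_point \<mu> A act m x \<and> besicovitch_ap_point \<mu> A act x"
proof -
  interpret prob_space m
    using assms(5) by (simp add: invariant_probability_measure_def)
  interpret ergodic_system_with_means m act \<mu> A x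
  proof unfold_locales
    show "compact (UNIV :: 'x set)"
      using assms(4) by (simp add: topological_dynamical_system_def)
    show "regular_borel_measure m" "distr m m (act t) = m" for t
      using assms(5) by (simp_all add: invariant_probability_measure_def)
  qed (rule assms)+
  show ?thesis
    using wiener_wintner_point_imp_generic_point wiener_wintner_point_imp_besicovitch_ap_point
      generic_besicovitch_ap_imp_wiener_wintner_point by blast
qed

end
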